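(* Let $f\in L^1(\mathbf{R}^2)$ and let $x\in\mathbf{R}^2$. Suppose that $f$ is piecewise smooth of class $C^2$ with respect to $x$, and let $a_1,\dots,a_K>0$ be the finitely many points at which the left and right limits of $\bar f_x$ or of its derivatives up to order $2$ do not agree. Then, as $M\to\infty$, $$f_M(x)-\bar f_x(0+0)=\sqrt{\frac{2}{M\pi}}\sum_{1\le i\le K}\delta\bar f_x(a_i)\,\frac{\cos(Ma_i-\pi/4)}{\sqrt{a_i}}+\frac{1}{M}\,\bar f_x'(0+0)+o(1/M).$$
   Context: For $f\in L^1(\mathbf{R}^2)$ the Fourier transform is $$\hat f(\xi_1,\xi_2)=\frac{1}{(2\pi)^2}\int_{\mathbf{R}^2}f(x_1,x_2)e^{-i(\xi_1x_1+\xi_2x_2)}\,dx_1dx_2,$$ and for $M>0$ the spherical partial sum is $$f_M(x_1,x_2)=\int_{\xi_1^2+\xi_2^2\le M^2}\hat f(\xi_1,\xi_2)e^{i(\xi_1x_1+\xi_2x_2)}\,d\xi_1d\xi_2.$$ The spherical mean value of $f$ with respect to $x=(x_1,x_2)$ is $$\bar f_x(r)=\frac{1}{2\pi}\int_0^{2\pi}f(x_1+r\cos\theta,\,x_2+r\sin\theta)\,d\theta,\qquad r>0.$$ The function $f$ is called piecewise smooth of class $C^k$ with respect to $x$ if the map $r\mapsto\bar f_x(r)$ is piecewise $C^k$ and there is $r(x)<\infty$ such that $\bar f_x(r)=0$ for $r\ge r(x)$. Piecewise $C^k$ means that there are finitely many points $0<a_1<\dots<a_K$ such that $\bar f_x$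 is $C^k$ on each of the open intervals into which they divide $(0,\infty)$, and $\bar f_x$ and its derivatives up to order $k$ have finite left and right limits at each $a_i$ and finite right limits at $0$. The left and right limits agree at every point other than the $a_i$. The jumps are $\delta\bar f_x(a_i):=\bar f_x(a_i+0)-\bar f_x(a_i-0)$, where $a_i\pm0$ denote right and left limits. $\bar f_x(0+0)$ and $\bar f_x'(0+0)$ denote the right limits at $0$ of $\bar f_x$ and of its derivative. *)

theory Defs
  imports "HOL-Analysis.Analysis" "HOL-Library.Landau_Symbols"
begin

definition fourier_transform :: "(real \<times> real \<Rightarrow> complex) \<Rightarrow> real \<times> real \<Rightarrow> complex" where
  "fourier_transform f \<xi> =
     1 / (2 * of_real pi)\<^sup>2 * (LINT x|lebesgue. f x * exp (- (\<i> * of_real (\<xi> \<bullet> x))))"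

definition spherical_partial_sum ::
    "(real \<times> real \<Rightarrow> complex) \<Rightarrow> real \<Rightarrow> real \<times> real \<Rightarrow> complex" where
  "spherical_partial_sum f M x =
     (LINT \<xi>:cball 0 M|lebesgue. fourier_transform f \<xi> * exp (\<i> * of_real (\<xi> \<bullet> x)))"

text \<open>If \<open>f\<close> is not integrable over the circle of radius \<open>r\<close>, the value below is \<open>0\<close>. For Lebesgue
  integrable \<open>f\<close> this happens only for a null set of radii.\<close>

definition spherical_mean ::
    "(real \<times> real \<Rightarrow> complex) \<Rightarrow> real \<times> real \<Rightarrow> real \<Rightarrow> complex" where
  "spherical_mean f x r =
     1 / (2 * of_real pi) *
     (LINT \<theta>:{0..2 * pi}|lebesgue. f (fst x + r * cos \<theta>, snd x + r * sin \<theta>))"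

definition nth_vector_derivative ::
    "nat \<Rightarrow> (real \<Rightarrow> complex) \<Rightarrow> real \<Rightarrow> complex" where
  "nth_vector_derivative j g = ((\<lambda>h r. vector_derivative h (at r)) ^^ j) g"

definition C_k_on :: "nat \<Rightarrow> (real \<Rightarrow> complex) \<Rightarrow> real set \<Rightarrow> bool" where
  "C_k_on k g S \<longleftrightarrow>
     (\<forall>j<k. \<forall>r\<in>S. nth_vector_derivative j g differentiable (at r)) \<and>
     (\<forall>j\<le>k. continuous_on S (nth_vector_derivative j g))"

text \<open>The open set \<open>{0<..} - A\<close> is the disjoint union of the open intervals into which the finite
  set \<open>A\<close> divides the positive half-line, so being \<open>C\<^sup>k\<close> on it is being \<open>C\<^sup>k\<close> on each of them. The
  filters \<^term>\<open>at_left a\<close> and \<^term>\<open>at_right a\<close> are punctured, so values at the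
  points of \<open>A\<close> play no role.\<close>

definition piecewise_C_k :: "nat \<Rightarrow> (real \<Rightarrow> complex) \<Rightarrow> bool" where
  "piecewise_C_k k g \<longleftrightarrow>
     (\<exists>A. finite A \<and> A \<subseteq> {0<..} \<and> C_k_on k g ({0<..} - A) \<and>
       (\<forall>j\<le>k. (\<exists>l. (nth_vector_derivative j g \<longlongrightarrow> l) (at_right 0)) \<and>
         (\<forall>a\<in>A. (\<exists>l. (nth_vector_derivative j g \<longlongrightarrow> l) (at_left a)) \<and>
                 (\<exists>l. (nth_vector_derivative j g \<longlongrightarrow> l) (at_right a)))))"

definition piecewise_smooth_wrt ::
    "nat \<Rightarrow> (real \<times> real \<Rightarrow> complex) \<Rightarrow> real \<times> real \<Rightarrow> bool" where
  "piecewise_smooth_wrt k f x \<longleftrightarrow>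
     piecewise_C_k k (spherical_mean f x) \<and> (\<exists>R. \<forall>r\<ge>R. spherical_mean f x r = 0)"

definition jump :: "(real \<Rightarrow> complex) \<Rightarrow> real \<Rightarrow> complex" where
  "jump g a = Lim (at_right a) g - Lim (at_left a) g"

definition jump_points :: "nat \<Rightarrow> (real \<Rightarrow> complex) \<Rightarrow> real set" where
  "jump_points k g =
     {a. 0 < a \<and> (\<exists>j\<le>k. Lim (at_left a) (nth_vector_derivative j g) \<noteq>
                         Lim (at_right a) (nth_vector_derivative j g))}"

end

theory Submission
  imports Defs "HOL-Probability.Sinc_Integral" "HOL-Probability.Distributions"
begin

text \<open>The kernel of the spherical partial sum is radial, so Fubini and polar coordinates turn the
  partial sum at \<open>x\<close> into the integral over \<open>r > 0\<close> of \<open>M * J1 (M * r)\<close> times the spherical mean. As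
  \<open>M * J1 (M * r)\<close> is the derivative of \<open>- J0 (M * r)\<close>, integration by parts on the smooth pieces produces
  the value at \<open>0\<close> and the jumps weighted by \<open>J0 (M * a)\<close>, whose leading term is the cosine. A second
  integration by parts, against the antiderivative of \<open>J0\<close> that vanishes at infinity, gives the
  derivative at \<open>0\<close>; what remains is \<open>o(1/M)\<close> by dominated convergence.\<close>

section \<open>Polar coordinates\<close>

text \<open>The jumps enter at order M^(-1/2) while the claim is accurate to o(1/M), so the cosine
  may replace \<open>bessel_J0 t\<close> only with an error o(1/t). To reach this accuracy, the
  contribution of the stationary point is written as a Fresnel integral, and a Gaussian average
  turns that into the integrals of 1 / (1 + y^4) and y^2 / (1 + y^4); their common value pi / sqrt 2
  produces the phase pi/4. The derivative at 0 has coefficient 1 because the integral of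
  \<open>bessel_J0\<close> over the half-line is 1. That integral converges only conditionally, so
  the antiderivative is given by an explicit formula containing the sine integral \<open>Si\<close>,
  whose limit is pi/2. Jumps of the derivative are weighted by the same antiderivative at M * a,
  which tends to 0, and so stay inside o(1/M). A separate obstacle is that f is only Lebesgue
  measurable and may fail to be measurable along a single circle; it is exchanged for a Borel
  representative, whose spherical means agree with those of f for almost every radius.\<close>

lemma nn_integral_minus_cot:
  fixes h :: "real \<Rightarrow> ennreal"
  assumes [measurable]: "h \<in> borel_measurable borel"
  shows "(\<integral>\<^sup>+s. h s \<partial>lborel)
    = (\<integral>\<^sup>+\<theta>. h (- cot \<theta>) * ennreal (1 / (sin \<theta>)\<^sup>2) * indicator {0<..<pi} \<theta> \<partial>lborel)"
proof -
  \<comment> \<open>The sets \<open>A n\<close> exhaust (0, pi) by compact intervals on which 1 /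
    (sin \<theta>)^2 is continuous, and \<open>B n\<close> are their images under the increasing map
    - cot. Since \<open>e n \<le> 1\<close> and pi > 3, each \<open>A n\<close> is nondegenerate.
    Monotone convergence passes to the limit.\<close>
  define e where "e n = 1 / real (n + 2)" for n
  define A where "A n = {e n .. pi - e n}" for n
  define B where "B n = {- cot (e n) .. - cot (pi - e n)}" for n
  have e0: "0 < e n" and e1: "e n \<le> 1" for n by (simp_all add: e_def)
  have e2: "e n < pi" "e n < pi - e n" "pi - e n < pi" for n using e0[of n] e1[of n] pi_gt3 by linarith+
  have e_mono: "e n \<le> e m" if "m \<le> n" for m n using that by (simp add: e_def field_simps)
  have lim0: "e \<longlonglongrightarrow> 0"
    unfolding e_def by (rule LIMSEQ_ignore_initial_segment[OF lim_1_over_n])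
  have sub: "0 < \<theta> \<and> \<theta> < pi" if "\<theta> \<in> A n" for n \<theta>
    using that e0[of n] by (simp add: A_def)
  have der: "((\<lambda>\<theta>. - cot \<theta>) has_real_derivative 1 / (sin \<theta>)\<^sup>2) (at \<theta>)" if "0 < \<theta> \<and> \<theta> < pi" for \<theta>
    using that sin_gt_zero[of \<theta>] DERIV_minus[OF DERIV_cot[of \<theta>]] by (simp add: inverse_eq_divide)
  have mono: "- cot x \<le> - cot y" if "0 < x" "x \<le> y" "y < pi" for x y
  proof (rule DERIV_nonneg_imp_nondecreasing[OF that(2)])
    fix z assume "x \<le> z" "z \<le> y"
    then show "\<exists>d. ((\<lambda>\<theta>. - cot \<theta>) has_real_derivative d) (at z) \<and> 0 \<le> d"
      using der[of z] that by (intro exI[of _ "1 / (sin z)\<^sup>2"]) auto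
  qed
  have step: "(\<integral>\<^sup>+s. h s * indicator (B n) s \<partial>lborel)
      = (\<integral>\<^sup>+\<theta>. h (- cot \<theta>) * ennreal (1 / (sin \<theta>)\<^sup>2) * indicator (A n) \<theta> \<partial>lborel)" for n
    unfolding A_def B_def
  proof (rule nn_integral_substitution_aux)
    have "sin \<theta> \<noteq> 0" if "\<theta> \<in> A n" for \<theta> using sub[OF that] sin_gt_zero[of \<theta>] by simp
    then show "continuous_on {e n..pi - e n} (\<lambda>\<theta>. 1 / (sin \<theta>)\<^sup>2)"
      by (intro continuous_intros) (simp add: A_def)
    show "((\<lambda>\<theta>. - cot \<theta>) has_real_derivative 1 / (sin x)\<^sup>2) (at x)" if "x \<in> {e n..pi - e n}" for x
      using der sub that unfolding A_def by blast
  qed (use e2 in simp_all)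
  have mB: "mono (\<lambda>n. B n)"
  proof (rule monoI)
    fix m n :: nat assume "m \<le> n"
    then have "- cot (e n) \<le> - cot (e m)" "- cot (pi - e m) \<le> - cot (pi - e n)"
      by (intro mono e0 e2 e_mono; use e_mono[of m n] e0[of m] e0[of n] e2[of m] in linarith)+
    then show "B m \<le> B n" by (simp add: B_def)
  qed
  have mA: "mono (\<lambda>n. A n)"
    using e_mono by (intro monoI) (simp add: A_def)
  have UA: "(\<Union>n. A n) = {0<..<pi}"
  proof (intro equalityI subsetI)
    fix \<theta> assume t: "\<theta> \<in> {0<..<pi}"
    then have "0 < min \<theta> (pi - \<theta>)" by simp
    from order_tendstoD(2)[OF lim0 this] obtain n where "e n < min \<theta> (pi - \<theta>)"
      by (auto simp: eventually_sequentially)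
    then have "\<theta> \<in> A n" by (simp add: A_def)
    then show "\<theta> \<in> (\<Union>n. A n)" by blast
  qed (use sub in auto)
  have UB: "(\<Union>n. B n) = UNIV"
  proof (intro equalityI subsetI)
    fix s :: real
    \<comment> \<open>The preimage of s in (0, pi), since - cot (pi/2 + u) = tan u.\<close>
    define \<theta> where "\<theta> = pi/2 + arctan s"
    have b: "\<theta> \<in> {0<..<pi}" using arctan_bounded[of s] by (auto simp: \<theta>_def)
    have "s = - cot \<theta>"
    proof -
      have "sin \<theta> = cos (arctan s)" "cos \<theta> = - sin (arctan s)"
        by (simp_all add: \<theta>_def sin_add cos_add)
      then have "- cot \<theta> = tan (arctan s)" by (simp add: cot_def tan_def)
      then show ?thesis by (simp add: tan_arctan)
    qed
    moreover obtain n where n: "\<theta> \<in> A n" using b UA by blast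
    moreover have "- cot (e n) \<le> - cot \<theta>" "- cot \<theta> \<le> - cot (pi - e n)"
      by (intro mono; use n b e0[of n] e2[of n] in \<open>simp add: A_def\<close>)+
    ultimately have "s \<in> B n" by (simp add: B_def)
    then show "s \<in> (\<Union>n. B n)" by blast
  qed auto
  have sA[measurable]: "A n \<in> sets borel" and sB[measurable]: "B n \<in> sets borel" for n by (auto simp: A_def B_def)
  have c[measurable]: "(\<lambda>\<theta>::real. - cot \<theta>) \<in> borel_measurable borel"
    unfolding cot_def by measurable
  have indS: "(SUP n. indicator (C n) s :: ennreal) = indicator (\<Union>n. C n) s" if "mono C" for C :: "nat \<Rightarrow> real set" and s
    by (intro LIMSEQ_unique[OF LIMSEQ_SUP LIMSEQ_indicator_incseq]) (use that in \<open>auto simp: incseq_def mono_def le_fun_def indicator_def\<close>)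
  have S: "(\<integral>\<^sup>+s. k s * indicator (\<Union>n. C n) s \<partial>lborel) = (SUP n. (\<integral>\<^sup>+s. k s * indicator (C n) s \<partial>lborel))"
    if "mono C" and [measurable]: "\<And>n. C n \<in> sets borel" "k \<in> borel_measurable borel" for C :: "nat \<Rightarrow> real set" and k :: "real \<Rightarrow> ennreal"
  proof -
    have "(SUP n. (\<integral>\<^sup>+s. k s * indicator (C n) s \<partial>lborel)) = (\<integral>\<^sup>+s. (SUP n. k s * indicator (C n) s) \<partial>lborel)"
      by (rule nn_integral_monotone_convergence_SUP[symmetric])
        (use \<open>mono C\<close> in \<open>auto simp: incseq_def mono_def le_fun_def indicator_def\<close>)
    then show ?thesis by (simp add: SUP_mult_left_ennreal[symmetric] indS[OF \<open>mono C\<close>])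
  qed
  have "(\<integral>\<^sup>+s. h s \<partial>lborel) = (\<integral>\<^sup>+s. h s * indicator (\<Union>n. B n) s \<partial>lborel)" by (simp add: UB)
  also have "\<dots> = (SUP n. (\<integral>\<^sup>+s. h s * indicator (B n) s \<partial>lborel))" by (rule S[OF mB]) auto
  also have "\<dots> = (SUP n. (\<integral>\<^sup>+\<theta>. h (- cot \<theta>) * ennreal (1 / (sin \<theta>)\<^sup>2) * indicator (A n) \<theta> \<partial>lborel))"
    by (simp only: step)
  also have "\<dots> = (\<integral>\<^sup>+\<theta>. h (- cot \<theta>) * ennreal (1 / (sin \<theta>)\<^sup>2) * indicator (\<Union>n. A n) \<theta> \<partial>lborel)"
    by (rule S[OF mA, symmetric]) auto
  finally show ?thesis by (simp add: UA)
qed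

text \<open>One-dimensional substitutions and Tonelli suffice: x = - y * s for fixed y, then s = -
  cot \<theta>, then y = r * sin \<theta> for fixed \<theta>. The factors |y| = |r| * sin \<theta>,
  1 / (sin \<theta>)^2 and sin \<theta> multiply to |r|. This sweeps the plane by lines through the
  origin, with \<theta> in (0, pi) and r of either sign; the half r < 0 is then reflected to the
  angles in (pi, 2 * pi).\<close>

lemma nn_integral_polar:
  fixes g :: "real \<times> real \<Rightarrow> ennreal"
  assumes [measurable]: "g \<in> borel_measurable borel"
  shows "(\<integral>\<^sup>+z. g z \<partial>lborel)
    = (\<integral>\<^sup>+r. (\<integral>\<^sup>+\<theta>. g (r * cos \<theta>, r * sin \<theta>) * indicator {0..2*pi} \<theta> \<partial>lborel)
        * ennreal r * indicator {0<..} r \<partial>lborel)"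
proof -
  have [measurable]: "g \<in> borel_measurable (borel \<Otimes>\<^sub>M borel)" by (simp add: borel_prod)
  have [measurable]: "cot \<in> borel_measurable (borel :: real measure)"
    unfolding cot_def[abs_def] by measurable
  define G where "G \<theta> r = g (r * cos \<theta>, r * sin \<theta>)" for \<theta> r :: real
  have [measurable]: "case_prod G \<in> borel_measurable (borel \<Otimes>\<^sub>M borel)" unfolding G_def by measurable
  have "(\<integral>\<^sup>+z. g z \<partial>lborel) = (\<integral>\<^sup>+z. g z \<partial>(lborel \<Otimes>\<^sub>M lborel))" by (simp add: lborel_prod)
  also have "\<dots> = (\<integral>\<^sup>+y. (\<integral>\<^sup>+x. g (x, y) \<partial>lborel) \<partial>lborel)"
    by (rule lborel_pair.nn_integral_snd[symmetric]) (simp add: lborel_prod)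
  also have "\<dots> = (\<integral>\<^sup>+y. (\<integral>\<^sup>+s. ennreal \<bar>y\<bar> * g (- y * s, y) \<partial>lborel) \<partial>lborel)"
  proof (rule nn_integral_cong_AE)
    show "AE y in lborel. (\<integral>\<^sup>+x. g (x, y) \<partial>lborel) = (\<integral>\<^sup>+s. ennreal \<bar>y\<bar> * g (- y * s, y) \<partial>lborel)"
      using AE_lborel_singleton[of 0]
    proof eventually_elim
      case (elim y)
      show ?case
        by (subst nn_integral_real_affine[of _ "-y" 0]) (use elim in \<open>auto simp: nn_integral_cmult\<close>)
    qed
  qed
  also have "\<dots> = (\<integral>\<^sup>+s. (\<integral>\<^sup>+y. ennreal \<bar>y\<bar> * g (- y * s, y) \<partial>lborel) \<partial>lborel)"
    by (rule lborel_pair.Fubini') measurable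
  also have "\<dots> = (\<integral>\<^sup>+\<theta>. (\<integral>\<^sup>+y. ennreal \<bar>y\<bar> * g (- y * (- cot \<theta>), y) \<partial>lborel) * ennreal (1 / (sin \<theta>)\<^sup>2) * indicator {0<..<pi} \<theta> \<partial>lborel)"
    by (rule nn_integral_minus_cot) measurable
  also have "\<dots> = (\<integral>\<^sup>+\<theta>. (\<integral>\<^sup>+r. ennreal \<bar>r\<bar> * G \<theta> r \<partial>lborel) * indicator {0<..<pi} \<theta> \<partial>lborel)"
  proof (rule nn_integral_cong)
    fix \<theta> :: real
    show "(\<integral>\<^sup>+y. ennreal \<bar>y\<bar> * g (- y * (- cot \<theta>), y) \<partial>lborel) * ennreal (1 / (sin \<theta>)\<^sup>2) * indicator {0<..<pi} \<theta>
      = (\<integral>\<^sup>+r. ennreal \<bar>r\<bar> * G \<theta> r \<partial>lborel) * indicator {0<..<pi} \<theta>"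
    proof (cases "\<theta> \<in> {0<..<pi}")
      case True
      then have s: "sin \<theta> > 0" by (simp add: sin_gt_zero)
      have "(\<integral>\<^sup>+y. ennreal \<bar>y\<bar> * g (- y * (- cot \<theta>), y) \<partial>lborel)
        = ennreal (sin \<theta>) * (\<integral>\<^sup>+r. ennreal \<bar>sin \<theta> * r\<bar> * g (- (sin \<theta> * r) * (- cot \<theta>), sin \<theta> * r) \<partial>lborel)"
        using s by (subst nn_integral_real_affine[of _ "sin \<theta>" 0]) auto
      also have "(\<lambda>r. ennreal \<bar>sin \<theta> * r\<bar> * g (- (sin \<theta> * r) * (- cot \<theta>), sin \<theta> * r))
        = (\<lambda>r. ennreal (sin \<theta>) * (ennreal \<bar>r\<bar> * G \<theta> r))"
        using s by (auto simp: fun_eq_iff G_def cot_def abs_mult ennreal_mult mult_ac)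
      also have "(\<integral>\<^sup>+r. ennreal (sin \<theta>) * (ennreal \<bar>r\<bar> * G \<theta> r) \<partial>lborel) = ennreal (sin \<theta>) * (\<integral>\<^sup>+r. (ennreal \<bar>r\<bar> * G \<theta> r) \<partial>lborel)"
        by (rule nn_integral_cmult) measurable
      finally have "(\<integral>\<^sup>+y. ennreal \<bar>y\<bar> * g (- y * (- cot \<theta>), y) \<partial>lborel) * ennreal (1 / (sin \<theta>)\<^sup>2)
         = (\<integral>\<^sup>+r. (ennreal \<bar>r\<bar> * G \<theta> r) \<partial>lborel) * (ennreal (sin \<theta>) * ennreal (sin \<theta>) * ennreal (1 / (sin \<theta>)\<^sup>2))"
        by (simp add: mult_ac)
      also have "ennreal (sin \<theta>) * ennreal (sin \<theta>) * ennreal (1 / (sin \<theta>)\<^sup>2) = 1"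
        using s by (simp add: ennreal_mult[symmetric] power2_eq_square)
      finally show ?thesis by simp
    qed simp
  qed
  also have "\<dots> = (\<integral>\<^sup>+\<theta>. (\<integral>\<^sup>+r. ennreal \<bar>r\<bar> * G \<theta> r * indicator {0<..<pi} \<theta> \<partial>lborel) \<partial>lborel)"
    by (subst nn_integral_multc) auto
  also have "\<dots> = (\<integral>\<^sup>+r. (\<integral>\<^sup>+\<theta>. ennreal \<bar>r\<bar> * G \<theta> r * indicator {0<..<pi} \<theta> \<partial>lborel) \<partial>lborel)"
    by (rule lborel_pair.Fubini') measurable
  also have "\<dots> = (\<integral>\<^sup>+r. ennreal \<bar>r\<bar> * (\<integral>\<^sup>+\<theta>. G \<theta> r * indicator {0<..<pi} \<theta> \<partial>lborel) \<partial>lborel)"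
    by (subst nn_integral_cmult[symmetric]) (auto simp: mult_ac)
  also have "\<dots> = (\<integral>\<^sup>+r. ennreal \<bar>r\<bar> * (\<integral>\<^sup>+\<theta>. G \<theta> r * indicator {0<..<pi} \<theta> \<partial>lborel) * indicator {0<..} r
        + ennreal \<bar>r\<bar> * (\<integral>\<^sup>+\<theta>. G \<theta> r * indicator {0<..<pi} \<theta> \<partial>lborel) * indicator {..<0} r \<partial>lborel)"
    by (rule nn_integral_cong) (auto simp: indicator_def)
  also have "\<dots> = (\<integral>\<^sup>+r. ennreal \<bar>r\<bar> * (\<integral>\<^sup>+\<theta>. G \<theta> r * indicator {0<..<pi} \<theta> \<partial>lborel) * indicator {0<..} r \<partial>lborel)
        + (\<integral>\<^sup>+r. ennreal \<bar>r\<bar> * (\<integral>\<^sup>+\<theta>. G \<theta> r * indicator {0<..<pi} \<theta> \<partial>lborel) * indicator {..<0} r \<partial>lborel)"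
    by (rule nn_integral_add) measurable
  also have "(\<integral>\<^sup>+r. ennreal \<bar>r\<bar> * (\<integral>\<^sup>+\<theta>. G \<theta> r * indicator {0<..<pi} \<theta> \<partial>lborel) * indicator {..<0} r \<partial>lborel)
       = (\<integral>\<^sup>+r. ennreal \<bar>r\<bar> * (\<integral>\<^sup>+\<theta>. G \<theta> (-r) * indicator {0<..<pi} \<theta> \<partial>lborel) * indicator {0<..} r \<partial>lborel)"
    by (subst nn_integral_real_affine[of _ "-1" 0]) (auto simp: indicator_def intro!: nn_integral_cong)
  also have "(\<lambda>r. \<integral>\<^sup>+\<theta>. G \<theta> (-r) * indicator {0<..<pi} \<theta> \<partial>lborel)
       = (\<lambda>r. \<integral>\<^sup>+\<theta>. G \<theta> r * indicator {pi<..<2*pi} \<theta> \<partial>lborel)"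
  proof
    fix r :: real
    have "(\<integral>\<^sup>+\<theta>. G \<theta> (-r) * indicator {0<..<pi} \<theta> \<partial>lborel) = (\<integral>\<^sup>+\<theta>. G (-pi + \<theta>) (-r) * indicator {0<..<pi} (-pi + \<theta>) \<partial>lborel)"
      by (subst nn_integral_real_affine[of _ "1" "-pi"]) auto
    also have "\<dots> = (\<integral>\<^sup>+\<theta>. G \<theta> r * indicator {pi<..<2*pi} \<theta> \<partial>lborel)"
      by (rule nn_integral_cong) (auto simp: indicator_def G_def cos_add sin_add)
    finally show "(\<integral>\<^sup>+\<theta>. G \<theta> (-r) * indicator {0<..<pi} \<theta> \<partial>lborel) = \<dots>" .
  qed
  also have "(\<integral>\<^sup>+r. ennreal \<bar>r\<bar> * (\<integral>\<^sup>+\<theta>. G \<theta> r * indicator {0<..<pi} \<theta> \<partial>lborel) * indicator {0<..} r \<partial>lborel)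
    + (\<integral>\<^sup>+r. ennreal \<bar>r\<bar> * (\<integral>\<^sup>+\<theta>. G \<theta> r * indicator {pi<..<2*pi} \<theta> \<partial>lborel) * indicator {0<..} r \<partial>lborel)
    = (\<integral>\<^sup>+r. ennreal \<bar>r\<bar> * (\<integral>\<^sup>+\<theta>. G \<theta> r * indicator {0<..<pi} \<theta> \<partial>lborel) * indicator {0<..} r
     + ennreal \<bar>r\<bar> * (\<integral>\<^sup>+\<theta>. G \<theta> r * indicator {pi<..<2*pi} \<theta> \<partial>lborel) * indicator {0<..} r \<partial>lborel)"
    by (rule nn_integral_add[symmetric]) measurable
  also have "\<dots> = (\<integral>\<^sup>+r. (\<integral>\<^sup>+\<theta>. G \<theta> r * indicator {0..2*pi} \<theta> \<partial>lborel) * ennreal r * indicator {0<..} r \<partial>lborel)"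
  proof (rule nn_integral_cong)
    fix r :: real
    have "(\<integral>\<^sup>+\<theta>. G \<theta> r * indicator {0<..<pi} \<theta> \<partial>lborel) + (\<integral>\<^sup>+\<theta>. G \<theta> r * indicator {pi<..<2*pi} \<theta> \<partial>lborel)
      = (\<integral>\<^sup>+\<theta>. G \<theta> r * indicator {0<..<pi} \<theta> + G \<theta> r * indicator {pi<..<2*pi} \<theta> \<partial>lborel)"
      by (rule nn_integral_add[symmetric]) measurable
    also have "\<dots> = (\<integral>\<^sup>+\<theta>. G \<theta> r * indicator {0..2*pi} \<theta> \<partial>lborel)"
    proof (rule nn_integral_cong_AE)
      show "AE \<theta> in lborel. G \<theta> r * indicator {0<..<pi} \<theta> + G \<theta> r * indicator {pi<..<2*pi} \<theta> = G \<theta> r * indicator {0..2*pi} \<theta>"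
        using AE_lborel_singleton[of 0] AE_lborel_singleton[of pi] AE_lborel_singleton[of "2*pi"]
        by eventually_elim (auto simp: indicator_def)
    qed
    finally show "ennreal \<bar>r\<bar> * (\<integral>\<^sup>+\<theta>. G \<theta> r * indicator {0<..<pi} \<theta> \<partial>lborel) * indicator {0<..} r
     + ennreal \<bar>r\<bar> * (\<integral>\<^sup>+\<theta>. G \<theta> r * indicator {pi<..<2*pi} \<theta> \<partial>lborel) * indicator {0<..} r
     = (\<integral>\<^sup>+\<theta>. G \<theta> r * indicator {0..2*pi} \<theta> \<partial>lborel) * ennreal r * indicator {0<..} r"
      by (auto simp: indicator_def distrib_left[symmetric] mult_ac)
  qed
  finally show ?thesis by (simp add: G_def)
qed

definition polar_point :: "real \<times> real \<Rightarrow> real \<times> real \<Rightarrow> real \<times> real" where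
  "polar_point x p = (fst x + fst p * cos (snd p), snd x + fst p * sin (snd p))"

text \<open>The Jacobian r together with the parameter domain, so that polar parameters carry a
  density on the whole product space.\<close>

definition polar_weight :: "real \<times> real \<Rightarrow> real" where
  "polar_weight p = fst p * indicator ({0<..} \<times> {0..2*pi}) p"

lemma polar_point_measurable [measurable]: "polar_point x \<in> borel \<Otimes>\<^sub>M borel \<rightarrow>\<^sub>M borel"
  unfolding polar_point_def[abs_def] borel_prod[symmetric] by measurable

lemma polar_weight_measurable [measurable]: "polar_weight \<in> borel_measurable (borel \<Otimes>\<^sub>M borel)"
  unfolding polar_weight_def[abs_def] by measurable

lemma polar_weight_nonneg: "polar_weight p \<ge> 0"
  by (auto simp: polar_weight_def indicator_def)

text \<open>Polar coordinates as an image measure: one equation then transfers null sets,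
  integrability and integrals of complex functions alike. Translation invariance moves the centre
  from 0 to x.\<close>

lemma lborel_polar:
  "lborel = distr (density (lborel \<Otimes>\<^sub>M lborel) (\<lambda>p. ennreal (polar_weight p))) borel (polar_point x)"
    (is "_ = distr ?P _ _")
proof (rule measure_eqI)
  fix A :: "(real \<times> real) set" assume "A \<in> sets lborel"
  then have [measurable]: "A \<in> sets borel" by simp
  have shift: "lborel = distr lborel borel ((+) x)" by (rule lborel_distr_plus[symmetric])
  have "emeasure lborel A = (\<integral>\<^sup>+z. indicator A z \<partial>lborel)" by simp
  also have "\<dots> = (\<integral>\<^sup>+z. indicator A (x + z) \<partial>lborel)"
    by (subst shift, subst nn_integral_distr) auto
  also have "\<dots> = (\<integral>\<^sup>+r. (\<integral>\<^sup>+\<theta>. indicator A (x + (r * cos \<theta>, r * sin \<theta>)) * indicator {0..2*pi} \<theta> \<partial>lborel)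
        * ennreal r * indicator {0<..} r \<partial>lborel)"
    by (rule nn_integral_polar) measurable
  also have "\<dots> = (\<integral>\<^sup>+r. (\<integral>\<^sup>+\<theta>. ennreal (polar_weight (r, \<theta>)) * indicator A (polar_point x (r, \<theta>)) \<partial>lborel) \<partial>lborel)"
  proof (rule nn_integral_cong)
    fix r :: real
    have [measurable]: "(\<lambda>\<theta>. indicator A (x + (r * cos \<theta>, r * sin \<theta>)) :: ennreal) \<in> borel_measurable borel"
    proof -
      have "(\<lambda>\<theta>. x + (r * cos \<theta>, r * sin \<theta>)) \<in> borel_measurable borel"
        by (intro borel_measurable_continuous_onI continuous_intros)
      then show ?thesis by measurable
    qed
    have "(\<integral>\<^sup>+\<theta>. indicator A (x + (r * cos \<theta>, r * sin \<theta>)) * indicator {0..2*pi} \<theta> \<partial>lborel)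
        * ennreal r * indicator {0<..} r
      = (\<integral>\<^sup>+\<theta>. indicator A (x + (r * cos \<theta>, r * sin \<theta>)) * indicator {0..2*pi} \<theta> * (ennreal r * indicator {0<..} r) \<partial>lborel)"
      by (subst nn_integral_multc) (auto simp: mult_ac)
    also have "\<dots> = (\<integral>\<^sup>+\<theta>. ennreal (polar_weight (r, \<theta>)) * indicator A (polar_point x (r, \<theta>)) \<partial>lborel)"
      by (rule nn_integral_cong)
        (simp add: polar_weight_def polar_point_def indicator_def plus_prod_def)
    finally show "(\<integral>\<^sup>+\<theta>. indicator A (x + (r * cos \<theta>, r * sin \<theta>)) * indicator {0..2*pi} \<theta> \<partial>lborel)
        * ennreal r * indicator {0<..} r = \<dots>" .
  qed
  also have "\<dots> = (\<integral>\<^sup>+p. ennreal (polar_weight p) * indicator A (polar_point x p) \<partial>(lborel \<Otimes>\<^sub>M lborel))"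
    by (rule lborel.nn_integral_fst) measurable
  also have "\<dots> = emeasure (distr ?P borel (polar_point x)) A"
  proof -
    have "emeasure (distr ?P borel (polar_point x)) A = emeasure ?P (polar_point x -` A \<inter> space ?P)"
      by (rule emeasure_distr) auto
    also have "\<dots> = (\<integral>\<^sup>+p. ennreal (polar_weight p) * indicator (polar_point x -` A \<inter> space ?P) p \<partial>(lborel \<Otimes>\<^sub>M lborel))"
      by (rule emeasure_density) (use measurable_sets[OF polar_point_measurable, of A] in \<open>auto simp: space_pair_measure\<close>)
    also have "\<dots> = (\<integral>\<^sup>+p. ennreal (polar_weight p) * indicator A (polar_point x p) \<partial>(lborel \<Otimes>\<^sub>M lborel))"
      by (rule nn_integral_cong) (auto simp: indicator_def space_pair_measure)
    finally show ?thesis ..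
  qed
  finally show "emeasure lborel A = emeasure (distr ?P borel (polar_point x)) A" .
qed auto

text \<open>A null set of the plane pulls back to a null set of polar parameters, which Fubini
  slices into circles. This allows functions that agree almost everywhere to be compared circle by
  circle.\<close>

lemma AE_polar:
  assumes "AE z in lborel. Q z"
  shows "AE r in lborel. 0 < r \<longrightarrow> (AE \<theta> in lborel. \<theta> \<in> {0..2*pi} \<longrightarrow> Q (fst x + r * cos \<theta>, snd x + r * sin \<theta>))"
proof -
  have "AE z in distr (density (lborel \<Otimes>\<^sub>M lborel) (\<lambda>p. ennreal (polar_weight p))) borel (polar_point x). Q z"
    using assms unfolding lborel_polar[symmetric] .
  then have "AE p in density (lborel \<Otimes>\<^sub>M lborel) (\<lambda>p. ennreal (polar_weight p)). Q (polar_point x p)"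
    by (rule AE_distrD[rotated]) auto
  then have "AE p in lborel \<Otimes>\<^sub>M lborel. 0 < ennreal (polar_weight p) \<longrightarrow> Q (polar_point x p)"
    by (subst (asm) AE_density) auto
  from lborel_pair.AE_pair[OF this] show ?thesis
  proof eventually_elim
    case (elim r)
    show ?case
    proof
      assume "0 < r"
      with elim show "AE \<theta> in lborel. \<theta> \<in> {0..2*pi} \<longrightarrow> Q (fst x + r * cos \<theta>, snd x + r * sin \<theta>)"
        by (auto simp: polar_weight_def polar_point_def indicator_def elim!: AE_mp)
    qed
  qed
qed

text \<open>Fubini for the image measure, the inner integral over the angle being 2 * pi * r times
  the spherical mean for r > 0. That identity holds at every such radius: where f is not integrable
  over the circle, both sides are 0.\<close>

lemma
  fixes f :: "real \<times> real \<Rightarrow> complex"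
  assumes f: "integrable lborel f"
  shows integrable_spherical_mean: "set_integrable lborel {0<..} (\<lambda>r. r * spherical_mean f x r)"
    and integral_spherical_mean:
      "(LINT z|lborel. f z) = 2 * pi * (LINT r:{0<..}|lborel. r * spherical_mean f x r)"
proof -
  let ?P = "density (lborel \<Otimes>\<^sub>M lborel) (\<lambda>p. ennreal (polar_weight p))"
  have [measurable]: "f \<in> borel_measurable borel" using f by auto
  have "integrable (distr ?P borel (polar_point x)) f" using f unfolding lborel_polar[symmetric] .
  then have "integrable ?P (\<lambda>p. f (polar_point x p))" by (rule integrable_distr[rotated]) auto
  then have int: "integrable (lborel \<Otimes>\<^sub>M lborel) (\<lambda>p. polar_weight p *\<^sub>R f (polar_point x p))"
    by (subst (asm) integrable_density) (auto simp: polar_weight_nonneg)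
  have "(LINT z|lborel. f z) = (LINT z|distr ?P borel (polar_point x). f z)" unfolding lborel_polar[symmetric] ..
  also have "\<dots> = (LINT p|?P. f (polar_point x p))" by (rule integral_distr) auto
  also have "\<dots> = (LINT p|(lborel \<Otimes>\<^sub>M lborel). polar_weight p *\<^sub>R f (polar_point x p))"
    by (rule integral_density) (auto simp: polar_weight_nonneg)
  also have "\<dots> = (LINT r|lborel. (LINT \<theta>|lborel. polar_weight (r, \<theta>) *\<^sub>R f (polar_point x (r, \<theta>))))"
    by (rule lborel_pair.integral_fst'[OF int, symmetric])
  finally have eq: "(LINT z|lborel. f z) = \<dots>" .
  have inner: "(LINT \<theta>|lborel. polar_weight (r, \<theta>) *\<^sub>R f (polar_point x (r, \<theta>)))
    = (2 * pi) * (indicator {0<..} r *\<^sub>R (r * spherical_mean f x r))" for r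
  proof -
    have c: "(\<lambda>\<theta>. (fst x + r * cos \<theta>, snd x + r * sin \<theta>)) \<in> borel_measurable borel"
      by (intro borel_measurable_continuous_onI continuous_intros)
    have m[measurable]: "(\<lambda>\<theta>. f (fst x + r * cos \<theta>, snd x + r * sin \<theta>)) \<in> borel_measurable borel"
      using measurable_compose[OF c \<open>f \<in> borel_measurable borel\<close>] .
    have "(LINT \<theta>|lborel. polar_weight (r, \<theta>) *\<^sub>R f (polar_point x (r, \<theta>)))
      = (LINT \<theta>|lborel. (r * indicator {0<..} r) *\<^sub>R (indicator {0..2*pi} \<theta> *\<^sub>R f (fst x + r * cos \<theta>, snd x + r * sin \<theta>)))"
      by (rule Bochner_Integration.integral_cong) (auto simp: polar_weight_def polar_point_def indicator_def)
    also have "\<dots> = (r * indicator {0<..} r) *\<^sub>R (LINT \<theta>:{0..2*pi}|lborel. f (fst x + r * cos \<theta>, snd x + r * sin \<theta>))"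
      unfolding set_lebesgue_integral_def by (rule integral_scaleR_right)
    also have "(LINT \<theta>:{0..2*pi}|lborel. f (fst x + r * cos \<theta>, snd x + r * sin \<theta>))
      = (LINT \<theta>:{0..2*pi}|lebesgue. f (fst x + r * cos \<theta>, snd x + r * sin \<theta>))"
      unfolding set_lebesgue_integral_def by (rule integral_completion[symmetric]) measurable
    finally show ?thesis
      by (simp add: spherical_mean_def indicator_def scaleR_conv_of_real)
  qed
  have "integrable lborel (\<lambda>r. (2 * pi) * (indicator {0<..} r *\<^sub>R (r * spherical_mean f x r)))"
    using lborel_pair.integrable_fst'[OF int] by (simp only: inner)
  then have "integrable lborel (\<lambda>r. complex_of_real (inverse (2 * pi)) * ((2 * pi) * (indicator {0<..} r *\<^sub>R (r * spherical_mean f x r))))"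
    by (rule integrable_mult_right)
  moreover have "complex_of_real (inverse (2 * pi)) * ((2 * pi) * z) = z" for z :: complex
    by (simp add: field_simps)
  ultimately show "set_integrable lborel {0<..} (\<lambda>r. r * spherical_mean f x r)"
    by (simp only: set_integrable_def)
  show "(LINT z|lborel. f z) = 2 * pi * (LINT r:{0<..}|lborel. r * spherical_mean f x r)"
    unfolding eq inner set_lebesgue_integral_def by (rule integral_mult_right_zero)
qed

section \<open>Borel representatives of Lebesgue integrable functions\<close>

lemma lebesgue_measurable_AE_eq:
  fixes h h' :: "'a::euclidean_space \<Rightarrow> 'b::topological_space"
  assumes h': "h' \<in> borel_measurable borel" and ae: "AE \<theta> in lborel. h \<theta> = h' \<theta>"
  shows "h \<in> borel_measurable lebesgue"
proof (rule borel_measurableI)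
  fix S :: "'b set" assume "open S"
  from ae obtain N where N: "N \<in> null_sets lborel" "{\<theta>. h \<theta> \<noteq> h' \<theta>} \<subseteq> N"
    by (auto simp: eventually_ae_filter)
  have "h -` S \<inter> space lebesgue = (h -` S \<inter> N) \<union> (h' -` S - N)" using N by auto
  moreover have "h -` S \<inter> N \<in> sets lebesgue"
    using N(1) null_sets_completion_iff2[of "h -` S \<inter> N" lborel] by auto
  moreover have "h' -` S - N \<in> sets lebesgue"
    using N(1) measurable_sets[OF h', of S] \<open>open S\<close> by (intro sets_completionI_sets) auto
  ultimately show "h -` S \<inter> space lebesgue \<in> sets lebesgue"
    by (simp only: sets.Un)
qed

text \<open>For almost every radius \<open>AE_polar\<close> gives agreement at almost all angles,
  and on such a circle completeness of Lebesgue measure makes f measurable along with f'. Only then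
  can the two integrals be identified.\<close>

lemma AE_spherical_mean_cong:
  assumes [measurable]: "f' \<in> borel_measurable borel" and ae: "AE z in lborel. f z = f' z"
  shows "AE r in lborel. 0 < r \<longrightarrow> spherical_mean f x r = spherical_mean f' x r"
  using AE_polar[OF ae, of x]
proof eventually_elim
  case (elim r)
  show ?case
  proof
    assume "0 < r"
    with elim have ae: "AE \<theta> in lborel. \<theta> \<in> {0..2*pi} \<longrightarrow> f (fst x + r * cos \<theta>, snd x + r * sin \<theta>) = f' (fst x + r * cos \<theta>, snd x + r * sin \<theta>)"
      by simp
    have c: "(\<lambda>\<theta>. (fst x + r * cos \<theta>, snd x + r * sin \<theta>)) \<in> borel_measurable borel"
      by (intro borel_measurable_continuous_onI continuous_intros)
    have m[measurable]: "(\<lambda>\<theta>. f' (fst x + r * cos \<theta>, snd x + r * sin \<theta>)) \<in> borel_measurable borel"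
      using measurable_compose[OF c \<open>f' \<in> borel_measurable borel\<close>] .
    let ?h = "\<lambda>\<theta>. indicator {0..2*pi} \<theta> *\<^sub>R f (fst x + r * cos \<theta>, snd x + r * sin \<theta>)"
    let ?h' = "\<lambda>\<theta>. indicator {0..2*pi} \<theta> *\<^sub>R f' (fst x + r * cos \<theta>, snd x + r * sin \<theta>)"
    have m': "?h' \<in> borel_measurable borel" by measurable
    have e: "AE \<theta> in lborel. ?h \<theta> = ?h' \<theta>" using ae by eventually_elim (auto simp: indicator_def)
    have "integral\<^sup>L lebesgue ?h = integral\<^sup>L lebesgue ?h'"
      using m' e by (intro integral_cong_AE lebesgue_measurable_AE_eq[OF m' e] AE_completion measurable_completion) auto
    then show "spherical_mean f x r = spherical_mean f' x r"
      by (simp add: spherical_mean_def set_lebesgue_integral_def)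
  qed
qed

lemma integrable_lebesgue_imp_ex_borel:
  fixes f :: "'a::euclidean_space \<Rightarrow> complex"
  assumes f: "integrable lebesgue f"
  obtains f' where "f' \<in> borel_measurable borel" "integrable lborel f'" "AE z in lborel. f z = f' z"
proof -
  have m: "f \<in> borel_measurable lebesgue" using f by auto
  have "(\<lambda>z. Re (f z)) \<in> borel_measurable lebesgue" "(\<lambda>z. Im (f z)) \<in> borel_measurable lebesgue"
    using m by measurable
  from this[THEN completion_ex_borel_measurable_real] obtain u v
    where uv: "u \<in> borel_measurable lborel" "AE z in lborel. Re (f z) = u z"
       "v \<in> borel_measurable lborel" "AE z in lborel. Im (f z) = v z" by blast
  define f' where "f' = (\<lambda>z. Complex (u z) (v z))"
  have f'alt: "f' = (\<lambda>z. of_real (u z) + \<i> * of_real (v z))"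
    by (auto simp: f'_def complex_eq_iff)
  have [measurable]: "u \<in> borel_measurable borel" "v \<in> borel_measurable borel" using uv by auto
  have f'm: "f' \<in> borel_measurable borel" unfolding f'alt by measurable
  have ae: "AE z in lborel. f z = f' z"
    using uv(2,4) by eventually_elim (auto simp: f'_def complex_eq_iff)
  have "integrable lebesgue f'"
    using f by (rule integrable_cong_AE_imp) (use f'm ae in \<open>auto intro!: measurable_completion AE_completion elim: AE_mp\<close>)
  then have "integrable lborel f'" using f'm by (simp add: integrable_completion)
  then show ?thesis using that f'm ae by blast
qed

section \<open>Bessel functions and the kernel of the disk\<close>

text \<open>The Bessel function of the first kind of order 0: Bessel's integral folded to a quarter
  period, where the phase is stationary at one end point only.\<close>

definition bessel_J0 :: "real \<Rightarrow> real" where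
  "bessel_J0 t = 2 / pi * integral {0..pi/2} (\<lambda>\<theta>. cos (t * sin \<theta>))"

text \<open>The Bessel function of order 1, in the form that differentiating
  \<open>bessel_J0\<close> under the integral sign produces up to sign.\<close>

definition bessel_J1 :: "real \<Rightarrow> real" where
  "bessel_J1 t = 2 / pi * integral {0..pi/2} (\<lambda>\<theta>. sin \<theta> * sin (t * sin \<theta>))"

lemma bessel_J0_0: "bessel_J0 0 = 1"
  by (simp add: bessel_J0_def)

lemma bessel_J0_deriv: "(bessel_J0 has_real_derivative - bessel_J1 t) (at t)"
proof -
  have "((\<lambda>t. integral (cbox 0 (pi/2)) (\<lambda>\<theta>. cos (t * sin \<theta>))) has_field_derivative
      integral (cbox 0 (pi/2)) (\<lambda>\<theta>. - (sin \<theta> * sin (t * sin \<theta>)))) (at t within UNIV)"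
    by (rule leibniz_rule_field_derivative)
      (auto intro!: derivative_eq_intros integrable_continuous_real continuous_intros simp: split_beta mult_ac)
  from DERIV_cmult[OF this, of "2/pi"] show ?thesis
    by (simp add: bessel_J0_def[abs_def] bessel_J1_def)
qed

text \<open>Integration by parts with the primitive - cos \<theta> of sin \<theta>; the boundary
  terms vanish because cos (pi/2) = 0 and sin 0 = 0. The factor t thus exposed is what the
  derivative of t * \<open>bessel_J1 t\<close> requires.\<close>

lemma bessel_J1_parts:
  "bessel_J1 t = t * (2 / pi * integral {0..pi/2} (\<lambda>\<theta>. (cos \<theta>)\<^sup>2 * cos (t * sin \<theta>)))"
proof -
  have "((\<lambda>\<theta>. sin \<theta> * sin (t * sin \<theta>) - t * ((cos \<theta>)\<^sup>2 * cos (t * sin \<theta>))) has_integral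
     (- cos (pi/2) * sin (t * sin (pi/2)) - (- cos 0 * sin (t * sin 0)))) {0..pi/2}"
    by (rule fundamental_theorem_of_calculus)
      (auto simp: has_real_derivative_iff_has_vector_derivative[symmetric] power2_eq_square mult_ac
        intro!: derivative_eq_intros)
  then have "integral {0..pi/2} (\<lambda>\<theta>. sin \<theta> * sin (t * sin \<theta>) - t * ((cos \<theta>)\<^sup>2 * cos (t * sin \<theta>))) = 0"
    by (simp add: integral_unique)
  moreover have "integral {0..pi/2} (\<lambda>\<theta>. sin \<theta> * sin (t * sin \<theta>) - t * ((cos \<theta>)\<^sup>2 * cos (t * sin \<theta>)))
    = integral {0..pi/2} (\<lambda>\<theta>. sin \<theta> * sin (t * sin \<theta>)) - integral {0..pi/2} (\<lambda>\<theta>. t * ((cos \<theta>)\<^sup>2 * cos (t * sin \<theta>)))"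
    by (intro Henstock_Kurzweil_Integration.integral_diff integrable_continuous_real continuous_intros)
  ultimately show ?thesis by (simp add: bessel_J1_def)
qed

text \<open>In J1 + t * J1' both summands become t times an integral of cos (t * sin \<theta>), with
  the weights (cos \<theta>)^2 and (sin \<theta>)^2, which add up to 1.\<close>

lemma mult_bessel_J1_deriv: "((\<lambda>t. t * bessel_J1 t) has_real_derivative t * bessel_J0 t) (at t)"
proof -
  have "((\<lambda>t. integral (cbox 0 (pi/2)) (\<lambda>\<theta>. sin \<theta> * sin (t * sin \<theta>))) has_field_derivative
      integral (cbox 0 (pi/2)) (\<lambda>\<theta>. (sin \<theta>)\<^sup>2 * cos (t * sin \<theta>))) (at t within UNIV)"
    by (rule leibniz_rule_field_derivative)
      (auto intro!: derivative_eq_intros integrable_continuous_real continuous_intros simp: split_beta mult_ac power2_eq_square)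
  from DERIV_cmult[OF this, of "2/pi"]
  have "(bessel_J1 has_real_derivative 2/pi * integral {0..pi/2} (\<lambda>\<theta>. (sin \<theta>)\<^sup>2 * cos (t * sin \<theta>))) (at t)"
    by (simp add: bessel_J1_def[abs_def])
  note DERIV_mult[OF DERIV_ident this]
  moreover have sum: "integral {0..pi/2} (\<lambda>\<theta>. (cos \<theta>)\<^sup>2 * cos (t * sin \<theta>)) + integral {0..pi/2} (\<lambda>\<theta>. (sin \<theta>)\<^sup>2 * cos (t * sin \<theta>))
      = integral {0..pi/2} (\<lambda>\<theta>. (cos \<theta>)\<^sup>2 * cos (t * sin \<theta>) + (sin \<theta>)\<^sup>2 * cos (t * sin \<theta>))"
    by (intro Henstock_Kurzweil_Integration.integral_add[symmetric] integrable_continuous_real continuous_intros)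
  have "bessel_J1 t + t * (2/pi * integral {0..pi/2} (\<lambda>\<theta>. (sin \<theta>)\<^sup>2 * cos (t * sin \<theta>))) = t * bessel_J0 t"
    unfolding bessel_J1_parts[of t] distrib_left[symmetric] sum bessel_J0_def
    by (simp add: distrib_right[symmetric])
  ultimately show ?thesis by (simp add: mult_ac add.commute)
qed

lemma bessel_continuous [continuous_intros]:
  shows "continuous_on S bessel_J0" and "continuous_on S bessel_J1"
proof -
  show "continuous_on S bessel_J0"
    by (meson DERIV_isCont bessel_J0_deriv continuous_at_imp_continuous_on)
  have "continuous_on UNIV (\<lambda>t. 2 / pi * integral (cbox 0 (pi/2)) (\<lambda>\<theta>. sin \<theta> * sin (t * sin \<theta>)))"
    by (intro continuous_intros integral_continuous_on_param) (auto simp: split_beta intro!: continuous_intros)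
  then show "continuous_on S bessel_J1"
    using continuous_on_subset by (fastforce simp: bessel_J1_def[abs_def])
qed

text \<open>The half-turn \<theta> + pi conjugates the integrand, so only the real part survives;
  the symmetry of sin about pi/2 then folds [0, pi] to the quarter period.\<close>

lemma integral_cis_sin: "integral {0..2*pi} (\<lambda>\<theta>. cis (R * sin \<theta>)) = 2 * pi * bessel_J0 R"
proof -
  have c: "continuous_on S (\<lambda>\<theta>. cis (R * sin \<theta>))" "continuous_on S (\<lambda>\<theta>. cis (- R * sin \<theta>))" for S
    by (intro continuous_intros)+
  note i = c[THEN integrable_continuous_real]
  have "integral {0..2*pi} (\<lambda>\<theta>. cis (R * sin \<theta>))
     = integral {0..pi} (\<lambda>\<theta>. cis (R * sin \<theta>)) + integral {pi..2*pi} (\<lambda>\<theta>. cis (R * sin \<theta>))"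
    by (rule Henstock_Kurzweil_Integration.integral_combine[symmetric]) (auto intro: i)
  also have "integral {pi..2*pi} (\<lambda>\<theta>. cis (R * sin \<theta>)) = integral {0..pi} (\<lambda>\<theta>. cis (- R * sin \<theta>))"
    using integral_shift[of 0 pi pi "\<lambda>\<theta>. cis (R * sin \<theta>)"] c(1) by (simp add: o_def)
  also have "integral {0..pi} (\<lambda>\<theta>. cis (R * sin \<theta>)) + integral {0..pi} (\<lambda>\<theta>. cis (- R * sin \<theta>))
    = integral {0..pi} (\<lambda>\<theta>. cis (R * sin \<theta>) + cis (- R * sin \<theta>))"
    by (rule Henstock_Kurzweil_Integration.integral_add[symmetric]) (rule i)+
  also have "(\<lambda>\<theta>. cis (R * sin \<theta>) + cis (- R * sin \<theta>)) = (\<lambda>\<theta>. of_real (2 * cos (R * sin \<theta>)))"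
    by (auto simp: fun_eq_iff complex_eq_iff)
  also have "integral {0..pi} (\<lambda>\<theta>. complex_of_real (2 * cos (R * sin \<theta>))) = of_real (integral {0..pi} (\<lambda>\<theta>. 2 * cos (R * sin \<theta>)))"
    by (rule integral_linear[OF _ bounded_linear_of_real, unfolded o_def])
      (intro integrable_continuous_real continuous_intros)
  also have "integral {0..pi} (\<lambda>\<theta>. 2 * cos (R * sin \<theta>)) = 2 * integral {0..pi} (\<lambda>\<theta>. cos (R * sin \<theta>))"
    by simp
  also have "integral {0..pi} (\<lambda>\<theta>. cos (R * sin \<theta>))
     = integral {0..pi/2} (\<lambda>\<theta>. cos (R * sin \<theta>)) + integral {pi/2..pi} (\<lambda>\<theta>. cos (R * sin \<theta>))"
    by (rule Henstock_Kurzweil_Integration.integral_combine[symmetric])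
      (auto intro!: integrable_continuous_real continuous_intros)
  also have "integral {pi/2..pi} (\<lambda>\<theta>. cos (R * sin \<theta>)) = integral {-pi/2..0} (\<lambda>\<theta>. cos (R * sin \<theta>))"
    using integral_shift[of "-pi/2" pi 0 "\<lambda>\<theta>. cos (R * sin \<theta>)"]
    by (simp add: o_def continuous_intros)
  also have "integral {-pi/2..0} (\<lambda>\<theta>. cos (R * sin \<theta>)) = integral {0..pi/2} (\<lambda>\<theta>. cos (R * sin \<theta>))"
    using Henstock_Kurzweil_Integration.integral_reflect_real[of "pi/2" 0 "\<lambda>\<theta>. cos (R * sin \<theta>)"] by simp
  finally show ?thesis by (simp add: bessel_J0_def)
qed

text \<open>Rotation invariance: the exponent equals R * sin (\<theta> + \<phi>), and the integral
  over a full period is independent of \<phi>. Indeed the derivatives in \<phi> and in \<theta> are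
  the same function \<open>D\<close>, and a \<theta>-derivative integrates to 0 over a
  period.\<close>

lemma integral_cis_cos_sin:
  "integral {0..2*pi} (\<lambda>\<theta>. cis (A * cos \<theta> + B * sin \<theta>)) = 2 * pi * bessel_J0 (sqrt (A\<^sup>2 + B\<^sup>2))"
proof -
  define R where "R = sqrt (A\<^sup>2 + B\<^sup>2)"
  define H where "H \<phi> = integral {0..2*pi} (\<lambda>\<theta>. cis (R * sin (\<theta> + \<phi>)))" for \<phi>
  define D where "D \<phi> \<theta> = (R * cos (\<theta> + \<phi>)) *\<^sub>R (\<i> * cis (R * sin (\<theta> + \<phi>)))" for \<phi> \<theta>
  have cis_d: "((\<lambda>s. cis (h s)) has_vector_derivative (h' *\<^sub>R (\<i> * cis (h s)))) (at s)"
    if "(h has_real_derivative h') (at s)" for h h' s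
    unfolding has_vector_derivative_complex_iff
    by (auto intro!: derivative_eq_intros that)
  have d1: "((\<lambda>\<phi>. cis (R * sin (\<theta> + \<phi>))) has_vector_derivative D \<phi> \<theta>) (at \<phi>)" for \<theta> \<phi>
    unfolding D_def by (rule cis_d) (auto intro!: derivative_eq_intros)
  have d2: "((\<lambda>\<theta>. cis (R * sin (\<theta> + \<phi>))) has_vector_derivative D \<phi> \<theta>) (at \<theta>)" for \<theta> \<phi>
    unfolding D_def by (rule cis_d) (auto intro!: derivative_eq_intros)
  have D0: "integral {0..2*pi} (D \<phi>) = 0" for \<phi>
  proof -
    have "(D \<phi> has_integral (cis (R * sin (2*pi + \<phi>)) - cis (R * sin (0 + \<phi>)))) {0..2*pi}"
      by (rule fundamental_theorem_of_calculus) (auto intro: has_vector_derivative_at_within d2)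
    then show ?thesis by (simp add: integral_unique sin_add)
  qed
  have "(H has_vector_derivative 0) (at \<phi> within UNIV)" for \<phi>
  proof -
    have "((\<lambda>\<phi>. integral (cbox 0 (2*pi)) (\<lambda>\<theta>. cis (R * sin (\<theta> + \<phi>)))) has_vector_derivative integral (cbox 0 (2*pi)) (D \<phi>)) (at \<phi> within UNIV)"
      by (rule leibniz_rule_vector_derivative)
        (auto simp: D_def split_beta intro!: d1[unfolded D_def] integrable_continuous_real continuous_intros)
    then show ?thesis using D0[of \<phi>] by (simp add: H_def[abs_def])
  qed
  from has_vector_derivative_zero_constant[OF convex_UNIV this] obtain c where c: "\<And>\<phi>. H \<phi> = c" by auto
  obtain \<phi> where AB: "B = R * cos \<phi>" "A = R * sin \<phi>"
  proof (cases "R = 0")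
    case True
    then have "A = 0" "B = 0" by (auto simp: R_def real_sqrt_eq_zero_cancel_iff sum_power2_eq_zero_iff)
    then show ?thesis using that[of 0] True by auto
  next
    case False
    then have "R > 0" by (simp add: R_def less_le)
    have R2: "A\<^sup>2 + B\<^sup>2 = R\<^sup>2" by (simp add: R_def)
    have "(B / R)\<^sup>2 + (A / R)\<^sup>2 = (A\<^sup>2 + B\<^sup>2) / R\<^sup>2"
      by (simp add: power_divide add_divide_distrib)
    also have "\<dots> = 1" unfolding R2 using \<open>R > 0\<close> by simp
    finally obtain \<phi> where "B / R = cos \<phi>" "A / R = sin \<phi>" using sincos_total_2pi by metis
    then show ?thesis using that[of \<phi>] \<open>R > 0\<close> by (simp add: field_simps)
  qed
  have "A * cos \<theta> + B * sin \<theta> = R * sin (\<theta> + \<phi>)" for \<theta>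
    by (simp add: AB sin_add algebra_simps)
  then have "integral {0..2*pi} (\<lambda>\<theta>. cis (A * cos \<theta> + B * sin \<theta>)) = H \<phi>" by (simp add: H_def)
  also have "\<dots> = H 0" by (simp add: c)
  also have "\<dots> = 2 * pi * bessel_J0 R" by (simp add: H_def integral_cis_sin)
  finally show ?thesis by (simp add: R_def)
qed

section \<open>The Fourier transform of the indicator of a disk\<close>

lemma has_integral_mult_bessel_J0:
  assumes "M \<ge> 0" "k > 0"
  shows "((\<lambda>\<rho>. \<rho> * bessel_J0 (k * \<rho>)) has_integral (M / k * bessel_J1 (M * k))) {0..M}"
proof -
  have "((\<lambda>\<rho>. \<rho> * bessel_J0 (k * \<rho>)) has_integral
      ((k * M) * bessel_J1 (k * M) / k\<^sup>2 - (k * 0) * bessel_J1 (k * 0) / k\<^sup>2)) {0..M}"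
  proof (rule fundamental_theorem_of_calculus[OF assms(1)])
    fix \<rho>
    have "((\<lambda>\<rho>. (k * \<rho>) * bessel_J1 (k * \<rho>)) has_real_derivative (k * \<rho> * bessel_J0 (k * \<rho>)) * k) (at \<rho>)"
      by (rule DERIV_chain2[OF mult_bessel_J1_deriv]) (auto intro!: derivative_eq_intros)
    from DERIV_cdivide[OF this, of "k\<^sup>2"]
    have "((\<lambda>\<rho>. (k * \<rho>) * bessel_J1 (k * \<rho>) / k\<^sup>2) has_real_derivative \<rho> * bessel_J0 (k * \<rho>)) (at \<rho>)"
      using assms by (simp add: power2_eq_square field_simps)
    then show "((\<lambda>\<rho>. (k * \<rho>) * bessel_J1 (k * \<rho>) / k\<^sup>2) has_vector_derivative \<rho> * bessel_J0 (k * \<rho>)) (at \<rho> within {0..M})"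
      by (simp add: has_real_derivative_iff_has_vector_derivative has_vector_derivative_at_within)
  qed
  then show ?thesis using assms by (simp add: power2_eq_square mult_ac)
qed

lemma lebesgue_integral_Icc_eq_integral:
  fixes h :: "real \<Rightarrow> complex"
  assumes "continuous_on {a..b} h"
  shows "(LINT \<theta>:{a..b}|lebesgue. h \<theta>) = integral {a..b} h"
proof -
  have si: "set_integrable lborel {a..b} h" by (rule borel_integrable_atLeastAtMost') fact
  then have "(\<lambda>\<theta>. indicator {a..b} \<theta> *\<^sub>R h \<theta>) \<in> borel_measurable lborel"
    by (auto simp: set_integrable_def)
  then have "(LINT \<theta>:{a..b}|lebesgue. h \<theta>) = (LINT \<theta>:{a..b}|lborel. h \<theta>)"
    unfolding set_lebesgue_integral_def by (rule integral_completion)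
  then show ?thesis using set_borel_integral_eq_integral(2)[OF si] by simp
qed

lemma norm_polar: "norm (r * cos \<theta>, r * sin \<theta>) = \<bar>r\<bar>" for r \<theta> :: real
proof -
  have "(r * cos \<theta>)\<^sup>2 + (r * sin \<theta>)\<^sup>2 = r\<^sup>2 * ((sin \<theta>)\<^sup>2 + (cos \<theta>)\<^sup>2)"
    by (simp only: power_mult_distrib distrib_left add.commute)
  then show ?thesis by (simp add: norm_Pair)
qed

lemma integrable_on_disk:
  fixes h :: "real \<times> real \<Rightarrow> complex"
  assumes "continuous_on UNIV h"
  shows "integrable lborel (\<lambda>\<xi>. indicator (cball 0 M) \<xi> *\<^sub>R h \<xi>)"
  using borel_integrable_compact[OF compact_cball continuous_on_subset[OF assms subset_UNIV]] .

text \<open>In polar coordinates about 0 the mean of the exponential over the circle of radius r is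
  \<open>bessel_J0 (norm z * r)\<close>, so that a single radial integral remains, evaluated by
  \<open>has_integral_mult_bessel_J0\<close>.\<close>

lemma disk_kernel:
  fixes z :: "real \<times> real"
  assumes M: "M \<ge> 0" and z: "z \<noteq> 0"
  shows "(LINT \<xi>:cball 0 M|lborel. exp (\<i> * of_real (\<xi> \<bullet> z))) = of_real (2 * pi * M / norm z * bessel_J1 (M * norm z))"
proof -
  define F where "F = (\<lambda>\<xi>::real \<times> real. indicator (cball 0 M) \<xi> *\<^sub>R exp (\<i> * of_real (\<xi> \<bullet> z)))"
  have "integrable lborel F" unfolding F_def by (rule integrable_on_disk) (auto intro!: continuous_intros)
  from integral_spherical_mean[OF this, of 0]
  have 1: "(LINT \<xi>|lborel. F \<xi>) = 2 * pi * (LINT r:{0<..}|lborel. r * spherical_mean F 0 r)" .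
  have sm: "spherical_mean F 0 r = indicator {..M} r *\<^sub>R of_real (bessel_J0 (norm z * r))" if "r > 0" for r
  proof -
    have n: "norm z = sqrt ((fst z)\<^sup>2 + (snd z)\<^sup>2)" by (cases z) (simp add: norm_Pair)
    have "F (r * cos \<theta>, r * sin \<theta>) = indicator {..M} r *\<^sub>R cis (r * fst z * cos \<theta> + r * snd z * sin \<theta>)" for \<theta>
      using that norm_polar[of r \<theta>]
      by (cases z) (simp add: F_def cis_conv_exp inner_prod_def indicator_def mult_ac)
    then have "spherical_mean F 0 r = 1 / (2 * of_real pi) *
      (indicator {..M} r *\<^sub>R (LINT \<theta>:{0..2*pi}|lebesgue. cis (r * fst z * cos \<theta> + r * snd z * sin \<theta>)))"
      by (simp add: spherical_mean_def)
    also have "(LINT \<theta>:{0..2*pi}|lebesgue. cis (r * fst z * cos \<theta> + r * snd z * sin \<theta>))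
       = integral {0..2*pi} (\<lambda>\<theta>. cis (r * fst z * cos \<theta> + r * snd z * sin \<theta>))"
      by (intro lebesgue_integral_Icc_eq_integral continuous_intros)
    also have "\<dots> = 2 * pi * bessel_J0 (sqrt ((r * fst z)\<^sup>2 + (r * snd z)\<^sup>2))" by (rule integral_cis_cos_sin)
    also have "sqrt ((r * fst z)\<^sup>2 + (r * snd z)\<^sup>2) = norm z * r"
      using that by (simp add: n power_mult_distrib distrib_left[symmetric] real_sqrt_mult)
    finally show ?thesis by (simp add: indicator_def)
  qed
  have "(LINT r:{0<..}|lborel. r * spherical_mean F 0 r)
     = (LINT r:{0<..M}|lborel. complex_of_real (r * bessel_J0 (norm z * r)))"
    unfolding set_lebesgue_integral_def by (rule Bochner_Integration.integral_cong) (auto simp: indicator_def sm)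
  also have "\<dots> = (LINT r:{0..M}|lborel. complex_of_real (r * bessel_J0 (norm z * r)))"
    unfolding set_lebesgue_integral_def
  proof (rule integral_cong_AE)
    have m: "(\<lambda>r. complex_of_real (r * bessel_J0 (norm z * r))) \<in> borel_measurable borel"
      by (intro borel_measurable_continuous_onI continuous_intros continuous_on_compose2[OF bessel_continuous(1)[of UNIV]]) auto
    show "(\<lambda>r. indicator {0<..M} r *\<^sub>R complex_of_real (r * bessel_J0 (norm z * r))) \<in> borel_measurable lborel"
      "(\<lambda>r. indicator {0..M} r *\<^sub>R complex_of_real (r * bessel_J0 (norm z * r))) \<in> borel_measurable lborel"
      using m by measurable
    show "AE r in lborel. indicator {0<..M} r *\<^sub>R complex_of_real (r * bessel_J0 (norm z * r))
        = indicator {0..M} r *\<^sub>R complex_of_real (r * bessel_J0 (norm z * r))"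
      using AE_lborel_singleton[of 0] by eventually_elim (auto simp: indicator_def)
  qed
  also have "\<dots> = of_real (LINT r:{0..M}|lborel. r * bessel_J0 (norm z * r))"
    by (simp only: set_integral_complex_of_real)
  also have "(LINT r:{0..M}|lborel. r * bessel_J0 (norm z * r)) = integral {0..M} (\<lambda>r. r * bessel_J0 (norm z * r))"
    by (intro set_borel_integral_eq_integral borel_integrable_atLeastAtMost' continuous_intros continuous_on_compose2[OF bessel_continuous(1)[of UNIV]]) auto
  also have "\<dots> = M / norm z * bessel_J1 (M * norm z)"
    using has_integral_mult_bessel_J0[OF M, of "norm z"] z by (simp add: integral_unique)
  finally show ?thesis using 1 by (simp add: F_def set_lebesgue_integral_def)
qed

text \<open>Fubini applies because the disk of frequencies has finite measure and h is integrable.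
  Integrating over the frequencies yields the disk kernel at x - y, which is radial about x and
  hence comes out of the spherical mean as a factor. The constants combine as 1 / (2 * pi)^2 * (2 *
  pi) * r * (2 * pi * M / r) = M.\<close>

lemma spherical_partial_sum_has_integral:
  assumes f: "integrable lebesgue f" and M: "M > 0"
  shows "((\<lambda>r. of_real (M * bessel_J1 (M * r)) * spherical_mean f x r) has_integral spherical_partial_sum f M x) {0<..}"
proof -
  obtain h where h[measurable]: "h \<in> borel_measurable borel" and hi: "integrable lborel h" and ae: "AE z in lborel. f z = h z"
    using integrable_lebesgue_imp_ex_borel[OF f] by blast
  have ft: "fourier_transform f \<xi> = 1 / (2 * of_real pi)\<^sup>2 * (LINT y|lborel. h y * exp (- (\<i> * of_real (\<xi> \<bullet> y))))" for \<xi>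
  proof -
    have e: "(\<lambda>y. exp (- (\<i> * of_real (\<xi> \<bullet> y))) :: complex) \<in> borel_measurable borel"
      by (rule borel_measurable_continuous_onI) (auto intro!: continuous_intros)
    have m: "(\<lambda>y. h y * exp (- (\<i> * of_real (\<xi> \<bullet> y)))) \<in> borel_measurable lborel" using e by measurable
    have "(\<lambda>y. exp (- (\<i> * of_real (\<xi> \<bullet> y))) :: complex) \<in> borel_measurable lebesgue"
      using e by (intro measurable_completion) simp
    then have m': "(\<lambda>y. f y * exp (- (\<i> * of_real (\<xi> \<bullet> y)))) \<in> borel_measurable lebesgue"
      using borel_measurable_integrable[OF f] by measurable
    have "(LINT y|lebesgue. f y * exp (- (\<i> * of_real (\<xi> \<bullet> y)))) = (LINT y|lebesgue. h y * exp (- (\<i> * of_real (\<xi> \<bullet> y))))"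
      by (rule integral_cong_AE[OF m' measurable_completion[OF m]]) (use ae in \<open>auto intro!: AE_completion\<close>)
    also have "\<dots> = (LINT y|lborel. h y * exp (- (\<i> * of_real (\<xi> \<bullet> y))))" by (rule integral_completion[OF m])
    finally show ?thesis by (simp add: fourier_transform_def)
  qed
  define \<Phi> where "\<Phi> = (\<lambda>(\<xi>, y). indicator (cball 0 M) \<xi> *\<^sub>R (h y * exp (\<i> * of_real (\<xi> \<bullet> (x - y)))))"
  have meas[measurable]: "(\<lambda>(\<xi>, y). exp (\<i> * of_real (\<xi> \<bullet> (x - y))) :: complex) \<in> borel_measurable (borel \<Otimes>\<^sub>M borel)"
    unfolding borel_prod by (intro borel_measurable_continuous_onI) (auto simp: split_beta intro!: continuous_intros)
  have \<Phi>_meas[measurable]: "\<Phi> \<in> borel_measurable (lborel \<Otimes>\<^sub>M lborel)"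
  proof -
    have "(\<lambda>p::(real\<times>real)\<times>(real\<times>real). indicator (cball 0 M) (fst p) :: real) \<in> borel_measurable (borel \<Otimes>\<^sub>M borel)"
      by (rule measurable_compose[OF measurable_fst borel_measurable_indicator]) simp
    moreover have "(\<lambda>p::(real\<times>real)\<times>(real\<times>real). h (snd p)) \<in> borel_measurable (borel \<Otimes>\<^sub>M borel)"
      by (rule measurable_compose[OF measurable_snd h])
    ultimately have "(\<lambda>p::(real\<times>real)\<times>(real\<times>real). indicator (cball 0 M) (fst p) *\<^sub>R (h (snd p) * (case p of (\<xi>, y) \<Rightarrow> exp (\<i> * of_real (\<xi> \<bullet> (x - y))))))
       \<in> borel_measurable (borel \<Otimes>\<^sub>M borel)"
      by (intro borel_measurable_scaleR borel_measurable_times meas)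
    moreover have "borel_measurable (lborel \<Otimes>\<^sub>M lborel) = (borel_measurable (borel \<Otimes>\<^sub>M borel) :: ((real \<times> real) \<times> (real \<times> real) \<Rightarrow> complex) set)"
      by (rule measurable_cong_sets) (auto intro: sets_pair_measure_cong)
    ultimately show ?thesis by (simp add: \<Phi>_def split_beta)
  qed
  have nrm: "norm (\<Phi> (\<xi>, y)) = indicator (cball 0 M) \<xi> * norm (h y)" for \<xi> y
    by (simp add: \<Phi>_def norm_mult)
  have \<Phi>_int: "integrable (lborel \<Otimes>\<^sub>M lborel) \<Phi>"
  proof (rule lborel_pair.Fubini_integrable[OF \<Phi>_meas])
    have "integrable lborel (\<lambda>\<xi>::real \<times> real. indicator (cball 0 M) \<xi> * (LINT y|lborel. norm (h y)))"
      by (intro integrable_mult_left integrable_real_indicator) (use emeasure_lborel_cball_finite[of "0 :: real \<times> real" M] in auto)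
    then show "integrable lborel (\<lambda>\<xi>. LINT y|lborel. norm (\<Phi> (\<xi>, y)))" by (simp add: nrm)
    show "AE \<xi> in lborel. integrable lborel (\<lambda>y. \<Phi> (\<xi>, y))"
    proof (rule AE_I2)
      fix \<xi> :: "real \<times> real"
      have "(\<lambda>y. \<Phi> (\<xi>, y)) \<in> borel_measurable lborel" by measurable
      then show "integrable lborel (\<lambda>y. \<Phi> (\<xi>, y))"
        by (rule Bochner_Integration.integrable_bound[OF hi]) (auto simp: nrm indicator_def)
    qed
  qed
  define c :: complex where "c = 1 / (2 * of_real pi)\<^sup>2"
  \<comment> \<open>The disk kernel as a function of the distance to x. The point y = x, to which
    \<open>disk_kernel\<close> does not apply, is a null set.\<close>
  define k where "k r = 2 * pi * M / r * bessel_J1 (M * r)" for r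
  define F where "F y = h y * of_real (k (norm (y - x)))" for y
  have e_add: "exp (- (\<i> * of_real (\<xi> \<bullet> y))) * exp (\<i> * of_real (\<xi> \<bullet> x)) = exp (\<i> * of_real (\<xi> \<bullet> (x - y)))" for \<xi> y :: "real \<times> real"
    by (simp add: exp_add[symmetric] inner_diff_right algebra_simps)
  have ps: "indicator (cball 0 M) \<xi> *\<^sub>R (fourier_transform f \<xi> * exp (\<i> * of_real (\<xi> \<bullet> x)))
      = c * (LINT y|lborel. \<Phi> (\<xi>, y))" for \<xi>
  proof -
    have "indicator (cball 0 M) \<xi> *\<^sub>R (fourier_transform f \<xi> * exp (\<i> * of_real (\<xi> \<bullet> x)))
      = c * (indicator (cball 0 M) \<xi> *\<^sub>R (LINT y|lborel. h y * exp (- (\<i> * of_real (\<xi> \<bullet> y))) * exp (\<i> * of_real (\<xi> \<bullet> x))))"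
      by (simp add: ft c_def)
    also have "\<dots> = c * (LINT y|lborel. indicator (cball 0 M) \<xi> *\<^sub>R (h y * exp (- (\<i> * of_real (\<xi> \<bullet> y))) * exp (\<i> * of_real (\<xi> \<bullet> x))))"
      by (simp only: integral_scaleR_right)
    finally show ?thesis unfolding \<Phi>_def prod.case mult.assoc e_add .
  qed
  have F_eq: "(LINT y|lborel. (LINT \<xi>|lborel. \<Phi> (\<xi>, y))) = (LINT y|lborel. F y)" and Fi: "integrable lborel F"
  proof -
    have eq: "(LINT \<xi>|lborel. \<Phi> (\<xi>, y)) = F y" if "y \<noteq> x" for y
    proof -
      have "(LINT \<xi>|lborel. \<Phi> (\<xi>, y)) = (LINT \<xi>|lborel. h y * (indicator (cball 0 M) \<xi> *\<^sub>R exp (\<i> * of_real (\<xi> \<bullet> (x - y)))))"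
        by (simp add: \<Phi>_def mult_ac)
      also have "\<dots> = h y * (LINT \<xi>:cball 0 M|lborel. exp (\<i> * of_real (\<xi> \<bullet> (x - y))))"
        unfolding set_lebesgue_integral_def by (rule integral_mult_right_zero)
      also have "\<dots> = F y"
        using disk_kernel[of M "x - y"] M that by (simp add: F_def k_def norm_minus_commute)
      finally show ?thesis .
    qed
    have kc: "(\<lambda>y::real\<times>real. complex_of_real (k (norm (y - x)))) \<in> borel_measurable borel"
    proof -
      have [measurable]: "bessel_J1 \<in> borel_measurable borel"
        by (intro borel_measurable_continuous_onI bessel_continuous)
      have "(\<lambda>y::real\<times>real. norm (y - x)) \<in> borel_measurable borel"
        by (intro borel_measurable_continuous_onI continuous_intros)
      moreover have "(\<lambda>r. complex_of_real (k r)) \<in> borel_measurable borel" unfolding k_def by measurable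
      ultimately show ?thesis by (rule measurable_compose)
    qed
    have Fm: "F \<in> borel_measurable lborel" unfolding F_def[abs_def] using kc by measurable
    have AEF: "AE y in lborel. (LINT \<xi>|lborel. \<Phi> (\<xi>, y)) = F y"
      using AE_lborel_singleton[of x] by eventually_elim (rule eq)
    have i: "integrable lborel (\<lambda>y. LINT \<xi>|lborel. \<Phi> (\<xi>, y))"
      using lborel_pair.integrable_snd[of "\<lambda>\<xi> y. \<Phi> (\<xi>, y)"] \<Phi>_int by simp
    show "(LINT y|lborel. (LINT \<xi>|lborel. \<Phi> (\<xi>, y))) = (LINT y|lborel. F y)"
      by (rule integral_cong_AE[OF borel_measurable_integrable[OF i] Fm AEF])
    show "integrable lborel F"
      by (rule integrable_cong_AE_imp[OF i Fm]) (use AEF in auto)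
  qed
  have "spherical_partial_sum f M x = (LINT \<xi>|lebesgue. c * (LINT y|lborel. \<Phi> (\<xi>, y)))"
    unfolding spherical_partial_sum_def set_lebesgue_integral_def ps ..
  also have "\<dots> = (LINT \<xi>|lborel. c * (LINT y|lborel. \<Phi> (\<xi>, y)))"
    by (rule integral_completion) measurable
  also have "\<dots> = c * (LINT \<xi>|lborel. (LINT y|lborel. \<Phi> (\<xi>, y)))" by (rule integral_mult_right_zero)
  also have "(LINT \<xi>|lborel. (LINT y|lborel. \<Phi> (\<xi>, y))) = (LINT y|lborel. (LINT \<xi>|lborel. \<Phi> (\<xi>, y)))"
    using lborel_pair.Fubini_integral[of "\<lambda>\<xi> y. \<Phi> (\<xi>, y)"] \<Phi>_int by simp
  also have "\<dots> = (LINT y|lborel. F y)" by (rule F_eq)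
  also have "(LINT y|lborel. F y) = 2 * pi * (LINT r:{0<..}|lborel. r * spherical_mean F x r)"
    by (rule integral_spherical_mean[OF Fi])
  finally have S: "spherical_partial_sum f M x = c * (2 * pi) * (LINT r:{0<..}|lborel. r * spherical_mean F x r)"
    by simp
  have smF: "spherical_mean F x r = of_real (k r) * spherical_mean h x r" if "r > 0" for r
  proof -
    have "F (fst x + r * cos \<theta>, snd x + r * sin \<theta>) = of_real (k r) * h (fst x + r * cos \<theta>, snd x + r * sin \<theta>)" for \<theta>
    proof -
      have "(fst x + r * cos \<theta>, snd x + r * sin \<theta>) - x = (r * cos \<theta>, r * sin \<theta>)"
        by (cases x) simp
      then show ?thesis using norm_polar[of r \<theta>] that by (simp add: F_def)
    qed
    then show ?thesis by (simp add: spherical_mean_def)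
  qed
  have "((\<lambda>r. r * spherical_mean F x r) has_integral (LINT r:{0<..}|lborel. r * spherical_mean F x r)) {0<..}"
    using set_borel_integral_eq_integral[OF integrable_spherical_mean[OF Fi, of x]]
    by (simp add: has_integral_integral)
  then have "((\<lambda>r. (c * (2 * pi)) * (r * spherical_mean F x r)) has_integral spherical_partial_sum f M x) {0<..}"
    unfolding S by (rule has_integral_mult_right)
  moreover have "(c * (2 * pi)) * (r * spherical_mean F x r) = of_real (M * bessel_J1 (M * r)) * spherical_mean h x r" if "r \<in> {0<..}" for r
    using that by (simp add: smF c_def k_def power2_eq_square field_simps)
  ultimately have "((\<lambda>r. of_real (M * bessel_J1 (M * r)) * spherical_mean h x r) has_integral spherical_partial_sum f M x) {0<..}"
    by (rule has_integral_eq[rotated])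
  \<comment> \<open>Return from the Borel representative h to f.\<close>
  moreover have "AE r in lborel. r \<in> {0<..} \<longrightarrow>
      of_real (M * bessel_J1 (M * r)) * spherical_mean h x r = of_real (M * bessel_J1 (M * r)) * spherical_mean f x r"
    using AE_spherical_mean_cong[OF h ae, of x] by eventually_elim auto
  ultimately show ?thesis by (rule has_integral_AE[THEN iffD1, rotated])
qed

section \<open>Asymptotics of the Bessel function\<close>

lemma quartic_pos: "0 < y\<^sup>2 + sqrt 2 * y + 1" "0 < y\<^sup>2 - sqrt 2 * y + 1" for y :: real
proof -
  have "y\<^sup>2 + sqrt 2 * y + 1 = (y + sqrt 2 / 2)\<^sup>2 + 1/2" "y\<^sup>2 - sqrt 2 * y + 1 = (y - sqrt 2 / 2)\<^sup>2 + 1/2"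
    by (simp_all add: power2_eq_square field_simps)
  then show "0 < y\<^sup>2 + sqrt 2 * y + 1" "0 < y\<^sup>2 - sqrt 2 * y + 1"
    by (simp_all add: add_nonneg_pos)
qed

lemma quartic_factor: "(y\<^sup>2 + sqrt 2 * y + 1) * (y\<^sup>2 - sqrt 2 * y + 1) = 1 + y ^ 4" for y :: real
proof -
  have "(y\<^sup>2 + sqrt 2 * y + 1) * (y\<^sup>2 - sqrt 2 * y + 1) = (y\<^sup>2 + 1)\<^sup>2 - (sqrt 2)\<^sup>2 * y\<^sup>2"
    by (simp only: power2_eq_square) (simp add: algebra_simps)
  then show ?thesis by (simp add: power2_eq_square power4_eq_xxxx algebra_simps)
qed

lemma one_plus_quartic_pos: "0 < 1 + y ^ 4" for y :: real
  using quartic_pos[of y] by (simp flip: quartic_factor)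

text \<open>Partial fractions over the two quadratic factors of 1 + y^4 leave a logarithmic and an
  arctangent part. The primitive of 1 / (1 + y^4) is \<open>quartic_arctan\<close> plus
  \<open>quartic_log\<close>, that of y^2 / (1 + y^4) is \<open>quartic_arctan\<close> minus
  \<open>quartic_log\<close>.\<close>

definition quartic_log :: "real \<Rightarrow> real" where
  "quartic_log y = (ln (y\<^sup>2 + sqrt 2 * y + 1) - ln (y\<^sup>2 - sqrt 2 * y + 1)) / (4 * sqrt 2)"

definition quartic_arctan :: "real \<Rightarrow> real" where
  "quartic_arctan y = (arctan (sqrt 2 * y + 1) + arctan (sqrt 2 * y - 1)) / (2 * sqrt 2)"

lemma quartic_log_deriv: "(quartic_log has_real_derivative (1 - y\<^sup>2) / (2 * (1 + y ^ 4))) (at y)"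
proof -
  have D: "(quartic_log has_real_derivative
     ((2 * y + sqrt 2) / (y\<^sup>2 + sqrt 2 * y + 1) - (2 * y - sqrt 2) / (y\<^sup>2 - sqrt 2 * y + 1)) / (4 * sqrt 2)) (at y)"
    unfolding quartic_log_def[abs_def] using quartic_pos[of y]
    by (intro DERIV_cdivide DERIV_diff) (auto intro!: derivative_eq_intros)
  have e1: "(2 * y + sqrt 2) / (y\<^sup>2 + sqrt 2 * y + 1) - (2 * y - sqrt 2) / (y\<^sup>2 - sqrt 2 * y + 1)
     = ((2 * y + sqrt 2) * (y\<^sup>2 - sqrt 2 * y + 1) - (2 * y - sqrt 2) * (y\<^sup>2 + sqrt 2 * y + 1)) / (1 + y ^ 4)"
    using quartic_pos[of y] by (simp add: diff_frac_eq quartic_factor)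
  have e2: "(2 * y + sqrt 2) * (y\<^sup>2 - sqrt 2 * y + 1) - (2 * y - sqrt 2) * (y\<^sup>2 + sqrt 2 * y + 1) = 2 * sqrt 2 * (1 - y\<^sup>2)"
    by (simp add: algebra_simps power2_eq_square)
  show ?thesis
    by (rule DERIV_cong[OF D[unfolded e1 e2]]) (use one_plus_quartic_pos[of y] in \<open>simp add: divide_simps, simp add: algebra_simps\<close>)
qed

lemma quartic_arctan_deriv: "(quartic_arctan has_real_derivative (1 + y\<^sup>2) / (2 * (1 + y ^ 4))) (at y)"
proof -
  have e: "1 + (sqrt 2 * y + 1)\<^sup>2 = 2 * (y\<^sup>2 + sqrt 2 * y + 1)" "1 + (sqrt 2 * y - 1)\<^sup>2 = 2 * (y\<^sup>2 - sqrt 2 * y + 1)"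
    by (simp_all add: power2_eq_square algebra_simps)
  have D: "(quartic_arctan has_real_derivative
     (sqrt 2 / (1 + (sqrt 2 * y + 1)\<^sup>2) + sqrt 2 / (1 + (sqrt 2 * y - 1)\<^sup>2)) / (2 * sqrt 2)) (at y)"
    unfolding quartic_arctan_def[abs_def]
    by (intro DERIV_cdivide DERIV_add) (auto intro!: derivative_eq_intros simp: inverse_eq_divide)
  have e1: "sqrt 2 / (1 + (sqrt 2 * y + 1)\<^sup>2) + sqrt 2 / (1 + (sqrt 2 * y - 1)\<^sup>2)
     = sqrt 2 / 2 * (((y\<^sup>2 - sqrt 2 * y + 1) + (y\<^sup>2 + sqrt 2 * y + 1)) / (1 + y ^ 4))"
    unfolding e quartic_factor[symmetric] using quartic_pos[of y] by (simp add: divide_simps) (simp add: algebra_simps)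
  show ?thesis
    by (rule DERIV_cong[OF D[unfolded e1]]) (use one_plus_quartic_pos[of y] in \<open>simp add: divide_simps, simp add: algebra_simps\<close>)
qed

text \<open>In the variable u = 1 / y the common factor y^2 of the two quadratics cancels, and the
  difference of logarithms is continuous at u = 0 with value 0. Both ends of the line become this
  one limit.\<close>

lemma quartic_log_limits: "(quartic_log \<longlongrightarrow> 0) at_top" "(quartic_log \<longlongrightarrow> 0) at_bot"
proof -
  define L where "L u = (ln (1 + sqrt 2 * u + u\<^sup>2) - ln (1 - sqrt 2 * u + u\<^sup>2)) / (4 * sqrt 2)" for u :: real
  have "(L \<longlongrightarrow> (ln (1 + sqrt 2 * 0 + 0\<^sup>2) - ln (1 - sqrt 2 * 0 + 0\<^sup>2)) / (4 * sqrt 2)) (nhds 0)"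
    unfolding L_def by (intro tendsto_intros filterlim_ident) auto
  then have L0: "(L \<longlongrightarrow> 0) (nhds 0)" by simp
  have eq: "quartic_log y = L (inverse y)" if "y \<noteq> 0" for y
  proof -
    have y2: "y\<^sup>2 > 0" using that by simp
    have a: "1 + sqrt 2 * inverse y + (inverse y)\<^sup>2 = (y\<^sup>2 + sqrt 2 * y + 1) / y\<^sup>2"
      "1 - sqrt 2 * inverse y + (inverse y)\<^sup>2 = (y\<^sup>2 - sqrt 2 * y + 1) / y\<^sup>2"
      using that by (simp_all add: field_simps power2_eq_square)
    show ?thesis unfolding L_def a quartic_log_def
      using quartic_pos[of y] y2 by (simp add: ln_div)
  qed
  show "(quartic_log \<longlongrightarrow> 0) at_top"
    by (rule tendsto_cong[THEN iffD1, OF _ filterlim_compose[OF L0 tendsto_inverse_0_at_top[OF filterlim_ident]]])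
      (use eventually_gt_at_top[of 0] in \<open>eventually_elim, simp add: eq\<close>)
  have ib: "((\<lambda>y::real. inverse y) \<longlongrightarrow> 0) at_bot"
    using tendsto_inverse_0 filterlim_mono at_bot_le_at_infinity by blast
  show "(quartic_log \<longlongrightarrow> 0) at_bot"
    by (rule tendsto_cong[THEN iffD1, OF _ filterlim_compose[OF L0 ib]])
      (use eventually_gt_at_bot[of "0::real"] in \<open>eventually_elim, simp add: eq\<close>)
qed

lemma quartic_arctan_limits:
  "(quartic_arctan \<longlongrightarrow> pi / (2 * sqrt 2)) at_top" "(quartic_arctan \<longlongrightarrow> - pi / (2 * sqrt 2)) at_bot"
proof -
  have le: "y \<le> sqrt 2 * y" if "0 \<le> y" for y :: real
    using mult_right_mono[of 1 "sqrt 2" y] that by simp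
  have t: "filterlim (\<lambda>y::real. sqrt 2 * y + c) at_top at_top" for c
    by (rule filterlim_at_top_mono[OF filterlim_tendsto_add_at_top[OF tendsto_const[of c] filterlim_ident]])
      (auto intro!: eventually_mono[OF eventually_ge_at_top[of 0]] simp: le)
  have b: "filterlim (\<lambda>y::real. sqrt 2 * y + c) at_bot at_bot" for c
    using t[of "-c"] by (simp add: filterlim_at_bot_mirror filterlim_uminus_at_top o_def)
  have "(quartic_arctan \<longlongrightarrow> (pi/2 + pi/2) / (2 * sqrt 2)) at_top"
    unfolding quartic_arctan_def[abs_def]
    using t[of 1] t[of "-1"] by (intro tendsto_intros filterlim_compose[OF tendsto_arctan_at_top]) auto
  then show "(quartic_arctan \<longlongrightarrow> pi / (2 * sqrt 2)) at_top" by simp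
  have "(quartic_arctan \<longlongrightarrow> (- (pi/2) + - (pi/2)) / (2 * sqrt 2)) at_bot"
    unfolding quartic_arctan_def[abs_def]
    using b[of 1] b[of "-1"] by (intro tendsto_intros filterlim_compose[OF tendsto_arctan_at_bot]) auto
  then show "(quartic_arctan \<longlongrightarrow> - pi / (2 * sqrt 2)) at_bot" by simp
qed

text \<open>For a nonnegative integrand, finite limits of a primitive at both ends already give
  absolute integrability.\<close>

lemma has_bochner_integral_FTC_nonneg_UNIV:
  fixes f F :: "real \<Rightarrow> real"
  assumes "\<And>y. (F has_real_derivative f y) (at y)" "continuous_on UNIV f" "\<And>y. f y \<ge> 0"
    and "(F \<longlongrightarrow> A) at_bot" "(F \<longlongrightarrow> B) at_top"
  shows "has_bochner_integral lborel f (B - A)"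
proof -
  have "set_integrable lborel (einterval (-\<infinity>) \<infinity>) f" "(LBINT x=-\<infinity>..\<infinity>. f x) = B - A"
    by (rule interval_integral_FTC_nonneg[where F = F];
        use assms in \<open>simp add: ereal_tendsto_simps continuous_on_eq_continuous_at\<close>)+
  then show ?thesis
    by (simp add: has_bochner_integral_iff interval_lebesgue_integral_def set_lebesgue_integral_def set_integrable_def)
qed

text \<open>The logarithmic part tends to 0 at both ends, so only the arctangent part contributes.
  It enters both primitives with the same sign, hence the equal values.\<close>

lemma has_bochner_integral_quartic:
  shows "has_bochner_integral lborel (\<lambda>y::real. 1 / (1 + y ^ 4)) (pi / sqrt 2)"
    and "has_bochner_integral lborel (\<lambda>y::real. y\<^sup>2 / (1 + y ^ 4)) (pi / sqrt 2)"
proof -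
  have p: "1 + y ^ 4 > 0" for y :: real
    by (rule one_plus_quartic_pos)
  have d: "1 + y ^ 4 \<noteq> 0" for y :: real using p[of y] by simp
  have al: "(1 + a) / (2 * q) - (1 - a) / (2 * q) = a / q" if "q \<noteq> 0" for a q :: real
    using that by (simp add: field_simps)
  have s: "pi / (2 * sqrt 2) - - pi / (2 * sqrt 2) = pi / sqrt 2"
    by (simp add: field_simps)
  have "has_bochner_integral lborel (\<lambda>y::real. 1 / (1 + y ^ 4)) ((0 + pi / (2 * sqrt 2)) - (0 + - pi / (2 * sqrt 2)))"
  proof (rule has_bochner_integral_FTC_nonneg_UNIV)
    fix y :: real
    show "((\<lambda>y. quartic_log y + quartic_arctan y) has_real_derivative 1 / (1 + y ^ 4)) (at y)"
      by (rule DERIV_cong[OF DERIV_add[OF quartic_log_deriv quartic_arctan_deriv]]) (use d[of y] in \<open>simp add: field_simps\<close>)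
    show "((\<lambda>y. quartic_log y + quartic_arctan y) \<longlongrightarrow> 0 + - pi / (2 * sqrt 2)) at_bot"
      "((\<lambda>y. quartic_log y + quartic_arctan y) \<longlongrightarrow> 0 + pi / (2 * sqrt 2)) at_top"
      by (intro tendsto_add quartic_log_limits quartic_arctan_limits)+
  qed (use p in \<open>auto intro!: continuous_intros simp: d less_imp_le\<close>)
  then show "has_bochner_integral lborel (\<lambda>y::real. 1 / (1 + y ^ 4)) (pi / sqrt 2)" using s by simp
  have "has_bochner_integral lborel (\<lambda>y::real. y\<^sup>2 / (1 + y ^ 4)) ((pi / (2 * sqrt 2) - 0) - (- pi / (2 * sqrt 2) - 0))"
  proof (rule has_bochner_integral_FTC_nonneg_UNIV)
    fix y :: real
    show "((\<lambda>y. quartic_arctan y - quartic_log y) has_real_derivative y\<^sup>2 / (1 + y ^ 4)) (at y)"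
      by (rule DERIV_cong[OF DERIV_diff[OF quartic_arctan_deriv quartic_log_deriv]]) (rule al[OF d])
    show "((\<lambda>y. quartic_arctan y - quartic_log y) \<longlongrightarrow> - pi / (2 * sqrt 2) - 0) at_bot"
      "((\<lambda>y. quartic_arctan y - quartic_log y) \<longlongrightarrow> pi / (2 * sqrt 2) - 0) at_top"
      by (intro tendsto_diff quartic_log_limits quartic_arctan_limits)+
  qed (use p in \<open>auto intro!: continuous_intros simp: d less_imp_le\<close>)
  then show "has_bochner_integral lborel (\<lambda>y::real. y\<^sup>2 / (1 + y ^ 4)) (pi / sqrt 2)" using s by simp
qed

section \<open>A Fresnel integral by Gaussian averaging\<close>

lemma has_bochner_integral_scaled_gaussian:
  assumes "x > 0"
  shows "has_bochner_integral lborel (\<lambda>y. x * exp (- (y\<^sup>2 * x\<^sup>2 / 2))) (sqrt (2 * pi))"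
proof -
  have "sqrt (2 * pi * (1 / x)\<^sup>2) = sqrt (2 * pi) / x"
    using assms by (simp add: real_sqrt_mult real_sqrt_divide)
  then have "sqrt (2 * pi) * normal_density 0 (1 / x) y = x * exp (- (y\<^sup>2 * x\<^sup>2 / 2))" for y
    using assms by (simp add: normal_density_def power_divide field_simps)
  moreover have "has_bochner_integral lborel (\<lambda>y. sqrt (2 * pi) * normal_density 0 (1 / x) y) (sqrt (2 * pi) * 1)"
    using assms by (intro has_bochner_integral_mult_right) (simp add: has_bochner_integral_iff)
  ultimately show ?thesis by simp
qed

text \<open>With u = x^2 / 2 the integrand is exp (- (y^2 * u)) * cos (t - u) du, the real part of
  an exponential with rate - (y^2 + i). Division by the rate brings in 1 + y^4, the squared modulus
  of y^2 + i.\<close>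

lemma gaussian_cos_antiderivative:
  fixes y t x :: real
  defines "G \<equiv> \<lambda>x. - (exp (- (y\<^sup>2 * x\<^sup>2 / 2)) * (y\<^sup>2 * cos (t - x\<^sup>2 / 2) + sin (t - x\<^sup>2 / 2)) / (1 + y ^ 4))"
  shows "(G has_real_derivative x * exp (- (y\<^sup>2 * x\<^sup>2 / 2)) * cos (t - x\<^sup>2 / 2)) (at x)"
proof -
  define E where "E = exp (- (y\<^sup>2 * x\<^sup>2 / 2))"
  define c where "c = cos (t - x\<^sup>2 / 2)"
  define s where "s = sin (t - x\<^sup>2 / 2)"
  have dE: "((\<lambda>x. exp (- (y\<^sup>2 * x\<^sup>2 / 2))) has_real_derivative - (y\<^sup>2 * x) * E) (at x)"
    unfolding E_def by (auto intro!: derivative_eq_intros)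
  have dT: "((\<lambda>x. y\<^sup>2 * cos (t - x\<^sup>2 / 2) + sin (t - x\<^sup>2 / 2)) has_real_derivative (y\<^sup>2 * (x * s) - x * c)) (at x)"
    unfolding c_def s_def by (auto intro!: derivative_eq_intros)
  have "(G has_real_derivative - ((- (y\<^sup>2 * x) * E * (y\<^sup>2 * c + s) + (y\<^sup>2 * (x * s) - x * c) * E) / (1 + y ^ 4))) (at x)"
    unfolding G_def using DERIV_minus[OF DERIV_cdivide[OF DERIV_mult[OF dE dT], of "1 + y ^ 4"]]
    by (simp add: E_def c_def s_def)
  moreover have "- (- (y\<^sup>2 * x) * E * (y\<^sup>2 * c + s) + (y\<^sup>2 * (x * s) - x * c) * E) = x * E * c * (1 + y ^ 4)"
    by (simp add: algebra_simps power2_eq_square power4_eq_xxxx)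
  then have "- ((- (y\<^sup>2 * x) * E * (y\<^sup>2 * c + s) + (y\<^sup>2 * (x * s) - x * c) * E) / (1 + y ^ 4)) = x * E * c"
    using one_plus_quartic_pos[of y] unfolding minus_divide_left by simp
  ultimately show ?thesis by (simp add: E_def c_def)
qed

text \<open>The factor sqrt (2 * pi) is the integral over y of x * exp (- (y^2 * x^2 / 2)), whatever
  x > 0 is; after exchanging the integrals the one over x is elementary. Its lower end point gives
  (y^2 * cos t + sin t) / (1 + y^4), which integrates to pi / sqrt 2 * (cos t + sin t) = pi * cos (t
  - pi / 4). At the upper end point the phase t - x^2 / 2 is 0, and this leaves the
  remainder.\<close>

lemma fresnel_eq:
  assumes t: "t > 0"
  shows "sqrt (2 * pi) * integral {0..sqrt (2 * t)} (\<lambda>w. cos (t - w\<^sup>2 / 2))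
    = pi * cos (t - pi / 4) - (LINT y|lborel. exp (- (y\<^sup>2 * t)) * y\<^sup>2 / (1 + y ^ 4))"
proof -
  define X where "X = sqrt (2 * t)"
  have X: "X > 0" "X\<^sup>2 = 2 * t" using t by (simp_all add: X_def)
  define \<Phi> where "\<Phi> = (\<lambda>(x, y). indicator {0..X} x * (x * exp (- (y\<^sup>2 * x\<^sup>2 / 2)) * cos (t - x\<^sup>2 / 2)))"
  have \<Phi>m[measurable]: "\<Phi> \<in> borel_measurable (lborel \<Otimes>\<^sub>M lborel)" unfolding \<Phi>_def by measurable
  have g: "has_bochner_integral lborel (\<lambda>y. \<Phi> (x, y)) (indicator {0..X} x * (sqrt (2 * pi) * cos (t - x\<^sup>2 / 2)))"
    if "x \<noteq> 0" for x
  proof (cases "x \<in> {0..X}")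
    case True
    then have "x > 0" using that by simp
    from has_bochner_integral_mult_left[OF has_bochner_integral_scaled_gaussian[OF this], of "cos (t - x\<^sup>2 / 2)"]
    show ?thesis using True by (simp add: \<Phi>_def mult_ac)
  qed (simp add: \<Phi>_def has_bochner_integral_zero)
  have ng: "(LINT y|lborel. norm (\<Phi> (x, y))) = indicator {0..X} x * (sqrt (2 * pi) * \<bar>cos (t - x\<^sup>2 / 2)\<bar>)"
    if "x \<noteq> 0" for x
  proof (cases "x \<in> {0..X}")
    case True
    then have "x > 0" using that by simp
    note has_bochner_integral_integral_eq[OF has_bochner_integral_mult_left[OF
          has_bochner_integral_scaled_gaussian[OF this], of "\<bar>cos (t - x\<^sup>2 / 2)\<bar>"]]
    moreover have "norm (\<Phi> (x, y)) = x * exp (- (y\<^sup>2 * x\<^sup>2 / 2)) * \<bar>cos (t - x\<^sup>2 / 2)\<bar>" for y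
      using True \<open>x > 0\<close> by (simp add: \<Phi>_def abs_mult)
    ultimately show ?thesis using True by simp
  qed (simp add: \<Phi>_def)
  have ic: "integrable lborel (\<lambda>x. indicator {0..X} x * (sqrt (2 * pi) * h x))" if "continuous_on UNIV h" for h :: "real \<Rightarrow> real"
    using borel_integrable_atLeastAtMost'[OF continuous_on_mult_left[OF continuous_on_subset[OF that subset_UNIV]], of 0 X "sqrt (2 * pi)"]
    by (simp add: set_integrable_def)
  have \<Phi>i: "integrable (lborel \<Otimes>\<^sub>M lborel) \<Phi>"
  proof (rule lborel_pair.Fubini_integrable[OF \<Phi>m])
    show "integrable lborel (\<lambda>x. LINT y|lborel. norm (\<Phi> (x, y)))"
    proof (rule integrable_cong_AE_imp[OF ic[of "\<lambda>x. \<bar>cos (t - x\<^sup>2 / 2)\<bar>"]])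
      show "AE x in lborel. indicator {0..X} x * (sqrt (2 * pi) * \<bar>cos (t - x\<^sup>2 / 2)\<bar>) = (LINT y|lborel. norm (\<Phi> (x, y)))"
        using AE_lborel_singleton[of 0] by eventually_elim (rule ng[symmetric])
      show "(\<lambda>x. LINT y|lborel. norm (\<Phi> (x, y))) \<in> borel_measurable lborel" by measurable
    qed (auto intro!: continuous_intros)
    show "AE x in lborel. integrable lborel (\<lambda>y. \<Phi> (x, y))"
      using AE_lborel_singleton[of 0] by eventually_elim (use g in \<open>auto simp: has_bochner_integral_iff\<close>)
  qed
  have inner: "(LINT x|lborel. \<Phi> (x, y)) = (y\<^sup>2 * cos t + sin t) / (1 + y ^ 4) - exp (- (y\<^sup>2 * t)) * y\<^sup>2 / (1 + y ^ 4)" for y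
  proof -
    have "(LINT x|lborel. \<Phi> (x, y)) = (LINT x:{0..X}|lborel. x * exp (- (y\<^sup>2 * x\<^sup>2 / 2)) * cos (t - x\<^sup>2 / 2))"
      by (simp add: \<Phi>_def set_lebesgue_integral_def)
    also have "\<dots> = integral {0..X} (\<lambda>x. x * exp (- (y\<^sup>2 * x\<^sup>2 / 2)) * cos (t - x\<^sup>2 / 2))"
      by (intro set_borel_integral_eq_integral borel_integrable_atLeastAtMost' continuous_intros) auto
    also have "\<dots> = - (exp (- (y\<^sup>2 * X\<^sup>2 / 2)) * (y\<^sup>2 * cos (t - X\<^sup>2 / 2) + sin (t - X\<^sup>2 / 2)) / (1 + y ^ 4))
       - - (exp (- (y\<^sup>2 * 0\<^sup>2 / 2)) * (y\<^sup>2 * cos (t - 0\<^sup>2 / 2) + sin (t - 0\<^sup>2 / 2)) / (1 + y ^ 4))"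
      using X(1) by (intro integral_unique fundamental_theorem_of_calculus)
        (auto intro!: has_field_derivative_at_within gaussian_cos_antiderivative
          simp: has_real_derivative_iff_has_vector_derivative[symmetric])
    finally show ?thesis by (simp add: X)
  qed
  have "sqrt (2 * pi) * integral {0..X} (\<lambda>w. cos (t - w\<^sup>2 / 2)) = integral {0..X} (\<lambda>w. sqrt (2 * pi) * cos (t - w\<^sup>2 / 2))"
    by simp
  also have "\<dots> = (LINT w:{0..X}|lborel. sqrt (2 * pi) * cos (t - w\<^sup>2 / 2))"
    by (intro set_borel_integral_eq_integral(2)[symmetric] borel_integrable_atLeastAtMost' continuous_intros) auto
  also have "\<dots> = (LINT x|lborel. (LINT y|lborel. \<Phi> (x, y)))"
    unfolding set_lebesgue_integral_def
  proof (rule integral_cong_AE)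
    show "AE x in lborel. indicator {0..X} x *\<^sub>R (sqrt (2 * pi) * cos (t - x\<^sup>2 / 2)) = (LINT y|lborel. \<Phi> (x, y))"
      using AE_lborel_singleton[of 0] by eventually_elim (simp add: has_bochner_integral_integral_eq[OF g])
  qed measurable
  also have "\<dots> = (LINT y|lborel. (LINT x|lborel. \<Phi> (x, y)))"
    using lborel_pair.Fubini_integral[of "\<lambda>x y. \<Phi> (x, y)"] \<Phi>i by simp
  also have "\<dots> = (LINT y|lborel. (y\<^sup>2 / (1 + y ^ 4) * cos t + 1 / (1 + y ^ 4) * sin t) - exp (- (y\<^sup>2 * t)) * y\<^sup>2 / (1 + y ^ 4))"
    unfolding inner by (simp add: add_divide_distrib)
  also have "\<dots> = (pi / sqrt 2 * cos t + pi / sqrt 2 * sin t) - (LINT y|lborel. exp (- (y\<^sup>2 * t)) * y\<^sup>2 / (1 + y ^ 4))"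
  proof -
    have b: "has_bochner_integral lborel (\<lambda>y. y\<^sup>2 / (1 + y ^ 4) * cos t + 1 / (1 + y ^ 4) * sin t) (pi / sqrt 2 * cos t + pi / sqrt 2 * sin t)"
      by (intro has_bochner_integral_add has_bochner_integral_mult_left has_bochner_integral_quartic)
    have i: "integrable lborel (\<lambda>y. exp (- (y\<^sup>2 * t)) * y\<^sup>2 / (1 + y ^ 4))"
    proof (rule Bochner_Integration.integrable_bound)
      show "integrable lborel (\<lambda>y::real. y\<^sup>2 / (1 + y ^ 4))"
        using has_bochner_integral_quartic(2) by (simp add: has_bochner_integral_iff)
      show "AE y in lborel. norm (exp (- (y\<^sup>2 * t)) * y\<^sup>2 / (1 + y ^ 4)) \<le> norm (y\<^sup>2 / (1 + y ^ 4))"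
      proof (rule AE_I2)
        fix y :: real
        have "exp (- (y\<^sup>2 * t)) * y\<^sup>2 \<le> 1 * y\<^sup>2" using t by (intro mult_right_mono) auto
        then show "norm (exp (- (y\<^sup>2 * t)) * y\<^sup>2 / (1 + y ^ 4)) \<le> norm (y\<^sup>2 / (1 + y ^ 4))"
          using one_plus_quartic_pos[of y] by (simp add: divide_right_mono abs_mult)
      qed
    qed measurable
    show ?thesis using b i by (simp add: has_bochner_integral_iff)
  qed
  also have "pi / sqrt 2 * cos t + pi / sqrt 2 * sin t = pi * cos (t - pi / 4)"
  proof -
    have "cos (t - pi / 4) = (cos t + sin t) * (sqrt 2 / 2)"
      by (simp only: cos_diff cos_45 sin_45 distrib_right)
    moreover have "pi / sqrt 2 = pi * (sqrt 2 / 2)" by (simp add: field_simps)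
    ultimately show ?thesis by (simp only: distrib_left distrib_right mult_ac)
  qed
  finally show ?thesis by (simp add: X_def)
qed

text \<open>From u \<le> exp u with u = y^2 * t, the remainder integrand is at most 1 / t times 1 /
  (1 + y^4). This rate suffices, since the Fresnel integral enters \<open>bessel_J0\<close> divided
  by sqrt t.\<close>

lemma fresnel_asymptotic:
  assumes t: "t > 0"
  shows "\<bar>sqrt (2 * pi) * integral {0..sqrt (2 * t)} (\<lambda>w. cos (t - w\<^sup>2 / 2)) - pi * cos (t - pi / 4)\<bar> \<le> pi / (sqrt 2 * t)"
proof -
  let ?h = "\<lambda>y::real. exp (- (y\<^sup>2 * t)) * y\<^sup>2 / (1 + y ^ 4)"
  have b: "?h y \<le> 1 / t * (1 / (1 + y ^ 4))" for y
  proof -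
    have "y\<^sup>2 * t \<le> exp (y\<^sup>2 * t)" using exp_ge_add_one_self[of "y\<^sup>2 * t"] by linarith
    then have "exp (- (y\<^sup>2 * t)) * y\<^sup>2 \<le> 1 / t" using t by (simp add: exp_minus field_simps)
    from divide_right_mono[OF this, of "1 + y ^ 4"] show ?thesis using one_plus_quartic_pos[of y] by simp
  qed
  have nn: "0 \<le> ?h y" for y using one_plus_quartic_pos[of y] by simp
  have Q: "has_bochner_integral lborel (\<lambda>y::real. 1 / t * (1 / (1 + y ^ 4))) (1 / t * (pi / sqrt 2))"
    by (intro has_bochner_integral_mult_right has_bochner_integral_quartic)
  have i: "integrable lborel ?h"
    by (rule Bochner_Integration.integrable_bound[of _ "\<lambda>y::real. 1 / t * (1 / (1 + y ^ 4))"])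
      (use Q b nn t one_plus_quartic_pos in \<open>auto simp: has_bochner_integral_iff intro!: AE_I2 less_imp_le abs_of_nonneg\<close>)
  have "(LINT y|lborel. ?h y) \<le> (LINT y|lborel. 1 / t * (1 / (1 + y ^ 4)))"
    by (rule integral_mono[OF i]) (use Q b in \<open>auto simp: has_bochner_integral_iff\<close>)
  also have "\<dots> = 1 / t * (pi / sqrt 2)" using Q by (rule has_bochner_integral_integral_eq)
  finally have "(LINT y|lborel. ?h y) \<le> pi / (sqrt 2 * t)" by (simp add: mult.commute)
  moreover have "0 \<le> (LINT y|lborel. ?h y)" using nn by (simp add: integral_nonneg_AE)
  ultimately show ?thesis unfolding fresnel_eq[OF t] by simp
qed

section \<open>Oscillatory integrals with phase t * cos \<theta>\<close>

lemma bessel_J0_cos: "bessel_J0 t = 2 / pi * integral {0..pi/2} (\<lambda>\<theta>. cos (t * cos \<theta>))"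
proof -
  have "integral {0..pi/2} (\<lambda>\<theta>. cos (t * cos \<theta>)) = integral {-pi/2..0} (\<lambda>\<theta>. cos (t * cos \<theta>))"
    using Henstock_Kurzweil_Integration.integral_reflect_real[of "pi/2" 0 "\<lambda>\<theta>. cos (t * cos \<theta>)"] by simp
  also have "\<dots> = integral {0..pi/2} (\<lambda>\<theta>. cos (t * cos (\<theta> - pi/2)))"
    using integral_shift[of 0 "-pi/2" "pi/2" "\<lambda>\<theta>. cos (t * cos \<theta>)"]
    by (simp add: o_def continuous_intros)
  also have "\<dots> = integral {0..pi/2} (\<lambda>\<theta>. cos (t * sin \<theta>))" by (simp add: cos_diff)
  finally show ?thesis by (simp add: bessel_J0_def)
qed

text \<open>The phase \<open>cos \<theta>\<close> is stationary at \<open>0\<close>, so a short interval there is estimated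
  trivially and the rest is integrated by parts.\<close>

lemma riemann_lebesgue_cos:
  fixes g g' :: "real \<Rightarrow> real"
  assumes dg: "\<And>\<theta>. \<theta> \<in> {0..pi/2} \<Longrightarrow> (g has_real_derivative g' \<theta>) (at \<theta>)"
    and cg': "continuous_on {0..pi/2} g'"
  shows "((\<lambda>t. integral {0..pi/2} (\<lambda>\<theta>. g \<theta> * sin (t * cos \<theta>))) \<longlongrightarrow> 0) at_top"
proof (rule tendstoI)
  fix e :: real assume e: "e > 0"
  have cg: "continuous_on {0..pi/2} g"
    using dg by (meson DERIV_isCont continuous_at_imp_continuous_on)
  obtain B where B: "B > 0" "\<And>\<theta>. \<theta> \<in> {0..pi/2} \<Longrightarrow> \<bar>g \<theta>\<bar> \<le> B"
    using compact_imp_bounded[OF compact_continuous_image[OF cg compact_Icc]]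
    unfolding bounded_pos by (auto simp: image_iff)
  \<comment> \<open>The integral over [0, d] is at most B * d, hence at most e / 4; the bound pi/4
    keeps d below pi/2.\<close>
  define d where "d = min (pi/4) (e / (4 * B))"
  have d: "0 < d" "d < pi/2" "d \<le> pi/2" "B * d \<le> e / 4"
  proof -
    show "0 < d" using e B(1) by (simp add: d_def)
    have "d \<le> pi/4" by (simp add: d_def)
    then show "d < pi/2" using pi_gt_zero by linarith
    then show "d \<le> pi/2" by simp
    have "B * d \<le> B * (e / (4 * B))" using B(1) by (intro mult_left_mono) (auto simp: d_def)
    then show "B * d \<le> e / 4" using B(1) by simp
  qed
  have sp: "0 < sin \<theta>" if "\<theta> \<in> {d..pi/2}" for \<theta>
    using that d pi_gt_zero by (intro sin_gt_zero) auto
  have sub: "{d..pi/2} \<subseteq> {0..pi/2}" using d by auto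
  \<comment> \<open>The integrand is h / t times the derivative t * sin \<theta> * sin (t * cos
    \<theta>) of cos (t * cos \<theta>); from d on, division by sin \<theta> is harmless.\<close>
  define h where "h \<theta> = g \<theta> / sin \<theta>" for \<theta>
  define h' where "h' \<theta> = (g' \<theta> * sin \<theta> - g \<theta> * cos \<theta>) / (sin \<theta> * sin \<theta>)" for \<theta>
  have dh: "(h has_real_derivative h' \<theta>) (at \<theta>)" if "\<theta> \<in> {d..pi/2}" for \<theta>
    unfolding h_def[abs_def] h'_def
    by (rule DERIV_divide) (use sp[OF that] dg sub that in \<open>auto intro!: DERIV_sin\<close>)
  have ch': "continuous_on {d..pi/2} h'"
    unfolding h'_def[abs_def] using sp
    by (intro continuous_intros continuous_on_subset[OF cg sub] continuous_on_subset[OF cg' sub]) force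
  obtain C where C: "C > 0" "\<And>\<theta>. \<theta> \<in> {d..pi/2} \<Longrightarrow> \<bar>h' \<theta>\<bar> \<le> C"
    using compact_imp_bounded[OF compact_continuous_image[OF ch' compact_Icc]]
    unfolding bounded_pos by (auto simp: image_iff)
  \<comment> \<open>Bounds for the two boundary terms and for the integral containing h'. The
    constant depends on e through d, but not on t.\<close>
  define K where "K = \<bar>h (pi/2)\<bar> + \<bar>h d\<bar> + C * (pi/2 - d)"
  have K: "K \<ge> 0" using C(1) d by (simp add: K_def)
  have bound: "\<bar>integral {0..pi/2} (\<lambda>\<theta>. g \<theta> * sin (t * cos \<theta>))\<bar> \<le> e / 4 + K / t" if t: "t > 0" for t
  proof -
    have ci: "continuous_on {0..pi/2} (\<lambda>\<theta>. g \<theta> * sin (t * cos \<theta>))"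
      by (intro continuous_intros cg)
    have "integral {0..pi/2} (\<lambda>\<theta>. g \<theta> * sin (t * cos \<theta>))
      = integral {0..d} (\<lambda>\<theta>. g \<theta> * sin (t * cos \<theta>)) + integral {d..pi/2} (\<lambda>\<theta>. g \<theta> * sin (t * cos \<theta>))"
      using d by (intro Henstock_Kurzweil_Integration.integral_combine[symmetric] integrable_continuous_real ci) auto
    moreover have "norm (integral {0..d} (\<lambda>\<theta>. g \<theta> * sin (t * cos \<theta>))) \<le> B * (d - 0)"
    proof (rule integral_bound)
      show "continuous_on {0..d} (\<lambda>\<theta>. g \<theta> * sin (t * cos \<theta>))"
        using d by (intro continuous_on_subset[OF ci]) auto
      show "norm (g \<theta> * sin (t * cos \<theta>)) \<le> B" if "\<theta> \<in> {0..d}" for \<theta>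
      proof -
        have "\<bar>g \<theta>\<bar> * \<bar>sin (t * cos \<theta>)\<bar> \<le> B * 1"
          using that d B(1) by (intro mult_mono B(2) abs_sin_le_one) auto
        then show ?thesis by (simp add: abs_mult)
      qed
    qed (use d in simp)
    moreover have "\<bar>integral {d..pi/2} (\<lambda>\<theta>. g \<theta> * sin (t * cos \<theta>))\<bar> \<le> K / t"
    proof -
      have cc: "continuous_on {d..pi/2} (\<lambda>\<theta>. cos (t * cos \<theta>) * h' \<theta>)"
        by (intro continuous_intros ch')
      have "((\<lambda>\<theta>. g \<theta> * sin (t * cos \<theta>) + cos (t * cos \<theta>) * h' \<theta> / t) has_integral
         (cos (t * cos (pi/2)) * h (pi/2) / t - cos (t * cos d) * h d / t)) {d..pi/2}"
      proof (rule fundamental_theorem_of_calculus[OF d(3)])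
        fix \<theta> assume th: "\<theta> \<in> {d..pi/2}"
        have "((\<lambda>\<theta>. cos (t * cos \<theta>)) has_real_derivative sin (t * cos \<theta>) * (t * sin \<theta>)) (at \<theta>)"
          by (auto intro!: derivative_eq_intros)
        from DERIV_cdivide[OF DERIV_mult[OF this dh[OF th]], of t]
        have "((\<lambda>\<theta>. cos (t * cos \<theta>) * h \<theta> / t) has_real_derivative
          (sin (t * cos \<theta>) * (t * sin \<theta>) * h \<theta> + h' \<theta> * cos (t * cos \<theta>)) / t) (at \<theta>)" .
        moreover have "(sin (t * cos \<theta>) * (t * sin \<theta>) * h \<theta> + h' \<theta> * cos (t * cos \<theta>)) / t
          = g \<theta> * sin (t * cos \<theta>) + cos (t * cos \<theta>) * h' \<theta> / t"
          using sp[OF th] t by (simp add: h_def field_simps)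
        ultimately show "((\<lambda>\<theta>. cos (t * cos \<theta>) * h \<theta> / t) has_vector_derivative
            g \<theta> * sin (t * cos \<theta>) + cos (t * cos \<theta>) * h' \<theta> / t) (at \<theta> within {d..pi/2})"
          by (simp add: has_real_derivative_iff_has_vector_derivative has_vector_derivative_at_within)
      qed
      then have "integral {d..pi/2} (\<lambda>\<theta>. g \<theta> * sin (t * cos \<theta>) + cos (t * cos \<theta>) * h' \<theta> / t)
          = h (pi/2) / t - cos (t * cos d) * h d / t" by (simp add: integral_unique)
      moreover have "integral {d..pi/2} (\<lambda>\<theta>. g \<theta> * sin (t * cos \<theta>) + cos (t * cos \<theta>) * h' \<theta> / t)
        = integral {d..pi/2} (\<lambda>\<theta>. g \<theta> * sin (t * cos \<theta>)) + integral {d..pi/2} (\<lambda>\<theta>. cos (t * cos \<theta>) * h' \<theta> / t)"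
        by (intro Henstock_Kurzweil_Integration.integral_add integrable_continuous_real continuous_intros ch'
            continuous_on_subset[OF cg sub]) (use t in auto)
      moreover have "integral {d..pi/2} (\<lambda>\<theta>. cos (t * cos \<theta>) * h' \<theta> / t) = integral {d..pi/2} (\<lambda>\<theta>. cos (t * cos \<theta>) * h' \<theta>) / t"
        by (rule Henstock_Kurzweil_Integration.integral_divide)
      ultimately have "integral {d..pi/2} (\<lambda>\<theta>. g \<theta> * sin (t * cos \<theta>))
        = (h (pi/2) - cos (t * cos d) * h d - integral {d..pi/2} (\<lambda>\<theta>. cos (t * cos \<theta>) * h' \<theta>)) / t"
        by (simp add: diff_divide_distrib)
      moreover have "\<bar>integral {d..pi/2} (\<lambda>\<theta>. cos (t * cos \<theta>) * h' \<theta>)\<bar> \<le> C * (pi/2 - d)"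
      proof -
        have "\<bar>cos (t * cos \<theta>)\<bar> * \<bar>h' \<theta>\<bar> \<le> 1 * C" if "\<theta> \<in> {d..pi/2}" for \<theta>
          using C that by (intro mult_mono) auto
        then show ?thesis using integral_bound[OF d(3) cc, of C] by (simp add: abs_mult)
      qed
      moreover have "\<bar>cos (t * cos d) * h d\<bar> \<le> \<bar>h d\<bar>"
        using mult_right_mono[OF abs_cos_le_one[of "t * cos d"], of "\<bar>h d\<bar>"] by (simp add: abs_mult)
      ultimately have "\<bar>integral {d..pi/2} (\<lambda>\<theta>. g \<theta> * sin (t * cos \<theta>))\<bar> * t \<le> K"
        using t by (simp add: abs_mult[symmetric] K_def abs_divide)
      then show ?thesis using t by (simp add: pos_le_divide_eq)
    qed
    ultimately show ?thesis using d(4) by simp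
  qed
  have "((\<lambda>t. K / t) \<longlongrightarrow> 0) at_top"
    by (rule real_tendsto_divide_at_top[OF tendsto_const filterlim_ident])
  then have "eventually (\<lambda>t. K / t < e / 2) at_top"
    by (rule order_tendstoD) (use e in simp)
  then show "eventually (\<lambda>t. dist (integral {0..pi/2} (\<lambda>\<theta>. g \<theta> * sin (t * cos \<theta>))) 0 < e) at_top"
    using eventually_gt_at_top[of 0]
  proof eventually_elim
    case (elim t)
    then show ?case using bound[of t] e by simp
  qed
qed

text \<open>Minus the integral of \<open>bessel_J0\<close> from T to infinity. Integrating
  \<open>bessel_J0\<close> from 0 to T under the integral sign gives sin (T * cos \<theta>) / cos
  \<theta>, where 1 / cos \<theta> = sin \<theta> / cos \<theta> + cos \<theta> / (1 + sin
  \<theta>). The first summand yields \<open>Si T\<close> by u = cos \<theta>; the second has a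
  smooth coefficient, to which \<open>riemann_lebesgue_cos\<close> applies. As \<open>Si\<close>
  tends to pi/2, subtracting 1 makes the limit vanish.\<close>

definition bessel_J0_tail :: "real \<Rightarrow> real" where
  "bessel_J0_tail T = 2 / pi * (Si T + integral {0..pi/2} (\<lambda>\<theta>. cos \<theta> / (1 + sin \<theta>) * sin (T * cos \<theta>))) - 1"

lemma one_plus_sin_pos: "0 < 1 + sin \<theta>" if "\<theta> \<in> {0..pi/2}"
proof -
  have "0 \<le> sin \<theta>" using that by (intro sin_ge_zero) auto
  then show ?thesis by simp
qed

lemma bessel_J0_tail_0: "bessel_J0_tail 0 = -1"
  by (simp add: bessel_J0_tail_def Si_def flip: zero_ereal_def)

text \<open>Since (cos \<theta>)^2 / (1 + sin \<theta>) = 1 - sin \<theta>, the derivative of the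
  integral is that of cos (T * cos \<theta>) minus \<open>sinc T\<close>, and the last term cancels
  the derivative of \<open>Si\<close>.\<close>

lemma bessel_J0_tail_deriv: "(bessel_J0_tail has_real_derivative bessel_J0 T) (at T)"
proof -
  have ne: "1 + sin \<theta> \<noteq> 0" if "\<theta> \<in> {0..pi/2}" for \<theta> using one_plus_sin_pos[OF that] by simp
  have "((\<lambda>T. integral (cbox 0 (pi/2)) (\<lambda>\<theta>. cos \<theta> / (1 + sin \<theta>) * sin (T * cos \<theta>))) has_field_derivative
      integral (cbox 0 (pi/2)) (\<lambda>\<theta>. cos \<theta> / (1 + sin \<theta>) * (cos (T * cos \<theta>) * cos \<theta>))) (at T within UNIV)"
    by (rule leibniz_rule_field_derivative)
      (use ne in \<open>auto intro!: derivative_eq_intros integrable_continuous_real continuous_intros simp: split_beta\<close>)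
  also have "integral (cbox 0 (pi/2)) (\<lambda>\<theta>. cos \<theta> / (1 + sin \<theta>) * (cos (T * cos \<theta>) * cos \<theta>))
     = integral {0..pi/2} (\<lambda>\<theta>. cos (T * cos \<theta>) - sin \<theta> * cos (T * cos \<theta>))"
  proof -
    have "cos \<theta> / (1 + sin \<theta>) * (cos (T * cos \<theta>) * cos \<theta>) = cos (T * cos \<theta>) - sin \<theta> * cos (T * cos \<theta>)"
      if "\<theta> \<in> {0..pi/2}" for \<theta>
    proof -
      have "cos \<theta> * cos \<theta> = (1 + sin \<theta>) * (1 - sin \<theta>)"
        using sin_cos_squared_add[of \<theta>] by (simp add: power2_eq_square algebra_simps)
      then have "cos \<theta> * cos \<theta> / (1 + sin \<theta>) = 1 - sin \<theta>" using ne[OF that] by simp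
      moreover have "cos \<theta> / (1 + sin \<theta>) * (cos (T * cos \<theta>) * cos \<theta>) = cos \<theta> * cos \<theta> / (1 + sin \<theta>) * cos (T * cos \<theta>)"
        by simp
      ultimately show ?thesis by (simp only: left_diff_distrib mult_1)
    qed
    then show ?thesis unfolding box_real by (rule Henstock_Kurzweil_Integration.integral_cong)
  qed
  also have "\<dots> = integral {0..pi/2} (\<lambda>\<theta>. cos (T * cos \<theta>)) - integral {0..pi/2} (\<lambda>\<theta>. sin \<theta> * cos (T * cos \<theta>))"
    by (intro Henstock_Kurzweil_Integration.integral_diff integrable_continuous_real continuous_intros)
  also have "integral {0..pi/2} (\<lambda>\<theta>. sin \<theta> * cos (T * cos \<theta>)) = sinc T"
  proof (cases "T = 0")
    case True
    have "((\<lambda>\<theta>. sin \<theta>) has_integral (- cos (pi/2) - - cos 0)) {0..pi/2}"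
      by (rule fundamental_theorem_of_calculus)
        (auto simp: has_real_derivative_iff_has_vector_derivative[symmetric] intro!: derivative_eq_intros)
    then show ?thesis using True by (simp add: integral_unique)
  next
    case False
    have "((\<lambda>\<theta>. sin \<theta> * cos (T * cos \<theta>)) has_integral (- sin (T * cos (pi/2)) / T - - sin (T * cos 0) / T)) {0..pi/2}"
      by (rule fundamental_theorem_of_calculus)
        (use False in \<open>auto simp: has_real_derivative_iff_has_vector_derivative[symmetric] intro!: derivative_eq_intros\<close>)
    then show ?thesis using False by (simp add: integral_unique)
  qed
  finally have d: "((\<lambda>T. integral {0..pi/2} (\<lambda>\<theta>. cos \<theta> / (1 + sin \<theta>) * sin (T * cos \<theta>))) has_field_derivative
     integral {0..pi/2} (\<lambda>\<theta>. cos (T * cos \<theta>)) - sinc T) (at T)"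
    by simp
  have "(bessel_J0_tail has_real_derivative 2 / pi * (sinc T + (integral {0..pi/2} (\<lambda>\<theta>. cos (T * cos \<theta>)) - sinc T)) - 0) (at T)"
    unfolding bessel_J0_tail_def[abs_def] by (intro DERIV_diff DERIV_cmult DERIV_add DERIV_Si d DERIV_const)
  then show ?thesis by (simp add: bessel_J0_cos)
qed

lemma bessel_J0_tail_at_top: "(bessel_J0_tail \<longlongrightarrow> 0) at_top"
proof -
  have "((\<lambda>T. integral {0..pi/2} (\<lambda>\<theta>. cos \<theta> / (1 + sin \<theta>) * sin (T * cos \<theta>))) \<longlongrightarrow> 0) at_top"
  proof (rule riemann_lebesgue_cos)
    fix \<theta> :: real assume "\<theta> \<in> {0..pi/2}"
    then have "1 + sin \<theta> \<noteq> 0" using one_plus_sin_pos[of \<theta>] by simp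
    then show "((\<lambda>\<theta>. cos \<theta> / (1 + sin \<theta>)) has_real_derivative
      (- sin \<theta> * (1 + sin \<theta>) - cos \<theta> * cos \<theta>) / ((1 + sin \<theta>) * (1 + sin \<theta>))) (at \<theta>)"
      by (auto intro!: derivative_eq_intros)
  next
    show "continuous_on {0..pi/2} (\<lambda>\<theta>. (- sin \<theta> * (1 + sin \<theta>) - cos \<theta> * cos \<theta>) / ((1 + sin \<theta>) * (1 + sin \<theta>)))"
      using one_plus_sin_pos by (intro continuous_intros) force
  qed
  then have "(bessel_J0_tail \<longlongrightarrow> 2 / pi * (pi / 2 + 0) - 1) at_top"
    unfolding bessel_J0_tail_def[abs_def] by (intro tendsto_intros Si_at_top)
  then show ?thesis by simp
qed

lemma bessel_J0_tail_bounded: "\<exists>B. \<forall>t\<ge>0. \<bar>bessel_J0_tail t\<bar> \<le> B"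
proof -
  from bessel_J0_tail_at_top have "eventually (\<lambda>t. \<bar>bessel_J0_tail t\<bar> < 1) at_top"
    by (auto simp: tendsto_iff dist_norm)
  then obtain T where T: "\<And>t. t \<ge> T \<Longrightarrow> \<bar>bessel_J0_tail t\<bar> < 1" by (auto simp: eventually_at_top_linorder)
  have "continuous_on {0..T} bessel_J0_tail"
    by (meson DERIV_isCont bessel_J0_tail_deriv continuous_at_imp_continuous_on)
  from compact_imp_bounded[OF compact_continuous_image[OF this compact_Icc]]
  obtain B where "\<And>y. y \<in> bessel_J0_tail ` {0..T} \<Longrightarrow> norm y \<le> B" unfolding bounded_iff by blast
  then have B: "\<bar>bessel_J0_tail t\<bar> \<le> B" if "t \<in> {0..T}" for t using that by force
  have "\<bar>bessel_J0_tail t\<bar> \<le> max B 1" if "t \<ge> 0" for t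
    using T[of t] B[of t] that by (cases "t \<ge> T") auto
  then show ?thesis by blast
qed

text \<open>Writing \<open>1 = cos (\<theta>/2) + (1 - cos (\<theta>/2))\<close>, the first summand is turned into a Fresnel
  integral by \<open>w = 2 * sqrt t * sin (\<theta>/2)\<close>, and the second vanishes at the stationary point.\<close>

lemma bessel_J0_asymptotic:
  "((\<lambda>t. t * (bessel_J0 t - sqrt (2 / (pi * t)) * cos (t - pi / 4))) \<longlongrightarrow> 0) at_top"
proof -
  \<comment> \<open>\<open>N\<close> over \<open>D\<close> is (1 - cos (\<theta> / 2)) / sin
    \<theta> with the 0 / 0 at \<theta> = 0 removed by half angles: \<open>D \<theta>\<close> = 2 *
    c * (1 + c) for c = cos (\<theta> / 2), which is positive on [0, pi/2]. So the quotient p is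
    smooth up to the stationary point, with p 0 = 0.\<close>
  define N where "N \<theta> = sin (\<theta> / 2)" for \<theta> :: real
  define D where "D \<theta> = 1 + 2 * cos (\<theta> / 2) + cos \<theta>" for \<theta> :: real
  define N' where "N' \<theta> = cos (\<theta> / 2) / 2" for \<theta> :: real
  define D' where "D' \<theta> = - sin (\<theta> / 2) - sin \<theta>" for \<theta> :: real
  define E where "E \<theta> = N' \<theta> * D \<theta> - N \<theta> * D' \<theta>" for \<theta>
  define E' where "E' \<theta> = (- sin (\<theta> / 2) / 4) * D \<theta> - N \<theta> * (- cos (\<theta> / 2) / 2 - cos \<theta>)" for \<theta>
  have dN: "(N has_real_derivative N' \<theta>) (at \<theta>)" for \<theta>
    unfolding N_def[abs_def] N'_def by (auto intro!: derivative_eq_intros)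
  have dD: "(D has_real_derivative D' \<theta>) (at \<theta>)" for \<theta>
    unfolding D_def[abs_def] D'_def by (auto intro!: derivative_eq_intros)
  have dN': "(N' has_real_derivative - sin (\<theta> / 2) / 4) (at \<theta>)" for \<theta>
    unfolding N'_def[abs_def] by (auto intro!: derivative_eq_intros)
  have dD': "(D' has_real_derivative - cos (\<theta> / 2) / 2 - cos \<theta>) (at \<theta>)" for \<theta>
    unfolding D'_def[abs_def] by (auto intro!: derivative_eq_intros)
  have dE: "(E has_real_derivative E' \<theta>) (at \<theta>)" for \<theta>
    unfolding E_def[abs_def]
    by (rule DERIV_cong[OF DERIV_diff[OF DERIV_mult[OF dN' dD] DERIV_mult[OF dN dD']]]) (simp add: E'_def algebra_simps)
  have Dpos: "D \<theta> > 0" if "\<theta> \<in> {0..pi/2}" for \<theta>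
  proof -
    have "cos \<theta> \<ge> 0" "cos (\<theta> / 2) \<ge> 0" using that by (auto intro!: cos_ge_zero)
    then show ?thesis by (simp add: D_def)
  qed
  define p where "p \<theta> = N \<theta> / D \<theta>" for \<theta>
  define p' where "p' \<theta> = E \<theta> / (D \<theta> * D \<theta>)" for \<theta>
  \<comment> \<open>The coefficient handed to \<open>riemann_lebesgue_cos\<close> is p', so its
    derivative must be continuous.\<close>
  define p'' where "p'' \<theta> = (E' \<theta> * (D \<theta> * D \<theta>) - E \<theta> * (D' \<theta> * D \<theta> + D' \<theta> * D \<theta>)) / ((D \<theta> * D \<theta>) * (D \<theta> * D \<theta>))" for \<theta>
  have dp: "(p has_real_derivative p' \<theta>) (at \<theta>)" if "\<theta> \<in> {0..pi/2}" for \<theta>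
    unfolding p_def[abs_def] p'_def E_def
    by (rule DERIV_divide) (use Dpos[OF that] dN dD in auto)
  have dp': "(p' has_real_derivative p'' \<theta>) (at \<theta>)" if "\<theta> \<in> {0..pi/2}" for \<theta>
    unfolding p'_def[abs_def] p''_def
    by (rule DERIV_divide) (use Dpos[OF that] dE DERIV_mult[OF dD dD] in auto)
  have cont: "continuous_on S E" "continuous_on S E'" "continuous_on S D" "continuous_on S D'" for S
    unfolding E_def[abs_def] E'_def[abs_def] D_def[abs_def] D'_def[abs_def] N_def[abs_def] N'_def[abs_def]
    by (auto intro!: continuous_intros)
  have cp': "continuous_on {0..pi/2} p'" unfolding p'_def[abs_def]
    using Dpos by (intro continuous_intros cont) force
  have cp'': "continuous_on {0..pi/2} p''" unfolding p''_def[abs_def]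
    using Dpos by (intro continuous_intros cont) force
  have p_eq: "sin \<theta> * p \<theta> = 1 - cos (\<theta> / 2)" if "\<theta> \<in> {0..pi/2}" for \<theta>
  proof -
    define s where "s = sin (\<theta> / 2)"
    define c where "c = cos (\<theta> / 2)"
    have sc: "s * s = 1 - c * c" using sin_squared_eq[of "\<theta> / 2"] by (simp add: s_def c_def power2_eq_square)
    have "sin \<theta> = 2 * s * c" using sin_double[of "\<theta> / 2"] by (simp add: s_def c_def)
    moreover have D2: "D \<theta> = 2 * c * (1 + c)"
      using cos_double_cos[of "\<theta> / 2"] by (simp add: D_def c_def power2_eq_square algebra_simps)
    moreover have "2 * s * c * s = 2 * c * (s * s)" by simp
    then have "2 * s * c * s = (1 - c) * (2 * c * (1 + c))"
      unfolding sc by (simp add: algebra_simps)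
    ultimately have "sin \<theta> * N \<theta> = (1 - c) * D \<theta>" by (simp add: N_def s_def)
    then show ?thesis using Dpos[OF that] by (simp add: p_def c_def)
  qed
  define R where "R t = integral {0..pi/2} (\<lambda>\<theta>. p' \<theta> * sin (t * cos \<theta>))" for t
  have R0: "(R \<longlongrightarrow> 0) at_top"
    unfolding R_def[abs_def] by (rule riemann_lebesgue_cos[OF dp' cp''])
  define I where "I t = integral {0..sqrt (2 * t)} (\<lambda>w. cos (t - w\<^sup>2 / 2))" for t :: real
  have J: "bessel_J0 t = 2 / pi * (I t / sqrt t + R t / t)" if t: "t > 0" for t
  proof -
    have split: "integral {0..pi/2} (\<lambda>\<theta>. cos (t * cos \<theta>))
      = integral {0..pi/2} (\<lambda>\<theta>. cos (\<theta> / 2) * cos (t * cos \<theta>)) + integral {0..pi/2} (\<lambda>\<theta>. (1 - cos (\<theta> / 2)) * cos (t * cos \<theta>))"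
      by (subst Henstock_Kurzweil_Integration.integral_add[symmetric])
        (auto intro!: integrable_continuous_real continuous_intros simp: left_diff_distrib)
    have w: "2 * sqrt t * sin (pi / 2 / 2) = sqrt (2 * t)"
      by (simp add: sin_45 real_sqrt_mult)
    \<comment> \<open>The phase is t * cos \<theta> = t - 2 * t * (sin (\<theta> / 2))^2 = t - w^2 /
      2, and dw = sqrt t * cos (\<theta> / 2) d\<theta>. The end point pi/2 goes to w = sqrt (2 *
      t), exactly the upper limit in \<open>fresnel_eq\<close>.\<close>
    have "((\<lambda>\<theta>. (sqrt t * cos (\<theta> / 2)) *\<^sub>R cos (t - (2 * sqrt t * sin (\<theta> / 2))\<^sup>2 / 2)) has_integral
        integral {2 * sqrt t * sin (0 / 2)..2 * sqrt t * sin (pi / 2 / 2)} (\<lambda>w. cos (t - w\<^sup>2 / 2))) {0..pi/2}"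
    proof (rule has_integral_substitution[where c = "- 2 * sqrt t" and d = "2 * sqrt t"])
      show "(\<lambda>\<theta>. 2 * sqrt t * sin (\<theta> / 2)) ` {0..pi/2} \<subseteq> {- 2 * sqrt t..2 * sqrt t}"
      proof clarify
        fix \<theta>
        have "\<bar>2 * sqrt t * sin (\<theta> / 2)\<bar> \<le> 2 * sqrt t * 1"
          using t unfolding abs_mult by (intro mult_mono) auto
        then show "2 * sqrt t * sin (\<theta> / 2) \<in> {- 2 * sqrt t..2 * sqrt t}" by (simp add: abs_le_iff)
      qed
      show "((\<lambda>\<theta>. 2 * sqrt t * sin (\<theta> / 2)) has_real_derivative sqrt t * cos (\<theta> / 2)) (at \<theta> within {0..pi/2})" for \<theta>
        by (auto intro!: derivative_eq_intros)
    qed (use t in \<open>auto simp: sin_45 intro!: continuous_intros\<close>)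
    then have "((\<lambda>\<theta>. sqrt t * (cos (\<theta> / 2) * cos (t * cos \<theta>))) has_integral I t) {0..pi/2}"
    proof -
      have "t - (2 * sqrt t * sin (\<theta> / 2))\<^sup>2 / 2 = t * cos \<theta>" for \<theta>
      proof -
        have "cos \<theta> = 1 - 2 * (sin (\<theta> / 2))\<^sup>2" using cos_double_sin[of "\<theta> / 2"] by simp
        then show ?thesis using t by (simp add: power_mult_distrib right_diff_distrib)
      qed
      with \<open>(_ has_integral integral {2 * sqrt t * sin (0 / 2)..2 * sqrt t * sin (pi / 2 / 2)} _) _\<close>
      show ?thesis unfolding w by (simp add: I_def mult.assoc)
    qed
    then have "sqrt t * integral {0..pi/2} (\<lambda>\<theta>. cos (\<theta> / 2) * cos (t * cos \<theta>)) = I t"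
      by (simp add: integral_unique flip: Henstock_Kurzweil_Integration.integral_mult_right)
    then have one: "integral {0..pi/2} (\<lambda>\<theta>. cos (\<theta> / 2) * cos (t * cos \<theta>)) = I t / sqrt t"
      using t by (simp add: field_simps)
    \<comment> \<open>The primitive vanishes at both ends: sin (t * cos (pi/2)) = 0 and p 0 = 0.
      Hence the second summand is exactly R t / t.\<close>
    have "((\<lambda>\<theta>. (1 - cos (\<theta> / 2)) * cos (t * cos \<theta>) - p' \<theta> * sin (t * cos \<theta>) / t) has_integral
        (- (sin (t * cos (pi/2)) * p (pi/2) / t) - - (sin (t * cos 0) * p 0 / t))) {0..pi/2}"
    proof (rule fundamental_theorem_of_calculus)
      fix \<theta> :: real assume th: "\<theta> \<in> {0..pi/2}"
      have "((\<lambda>\<theta>. sin (t * cos \<theta>)) has_real_derivative - (cos (t * cos \<theta>) * (t * sin \<theta>))) (at \<theta>)"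
        by (auto intro!: derivative_eq_intros)
      from DERIV_minus[OF DERIV_cdivide[OF DERIV_mult[OF this dp[OF th]], of t]]
      have "((\<lambda>\<theta>. - (sin (t * cos \<theta>) * p \<theta> / t)) has_real_derivative
         - ((- (cos (t * cos \<theta>) * (t * sin \<theta>)) * p \<theta> + p' \<theta> * sin (t * cos \<theta>)) / t)) (at \<theta>)" .
      moreover have "- ((- (cos (t * cos \<theta>) * (t * sin \<theta>)) * p \<theta> + p' \<theta> * sin (t * cos \<theta>)) / t)
        = (1 - cos (\<theta> / 2)) * cos (t * cos \<theta>) - p' \<theta> * sin (t * cos \<theta>) / t"
        unfolding p_eq[OF th, symmetric] using t by (simp add: field_simps)
      ultimately show "((\<lambda>\<theta>. - (sin (t * cos \<theta>) * p \<theta> / t)) has_vector_derivative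
         (1 - cos (\<theta> / 2)) * cos (t * cos \<theta>) - p' \<theta> * sin (t * cos \<theta>) / t) (at \<theta> within {0..pi/2})"
        by (simp add: has_real_derivative_iff_has_vector_derivative has_vector_derivative_at_within)
    qed simp
    then have "integral {0..pi/2} (\<lambda>\<theta>. (1 - cos (\<theta> / 2)) * cos (t * cos \<theta>) - p' \<theta> * sin (t * cos \<theta>) / t) = 0"
      by (simp add: integral_unique p_def N_def)
    moreover have "integral {0..pi/2} (\<lambda>\<theta>. (1 - cos (\<theta> / 2)) * cos (t * cos \<theta>) - p' \<theta> * sin (t * cos \<theta>) / t)
      = integral {0..pi/2} (\<lambda>\<theta>. (1 - cos (\<theta> / 2)) * cos (t * cos \<theta>)) - integral {0..pi/2} (\<lambda>\<theta>. p' \<theta> * sin (t * cos \<theta>) / t)"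
      using t by (intro Henstock_Kurzweil_Integration.integral_diff integrable_continuous_real continuous_intros cp') auto
    moreover have "integral {0..pi/2} (\<lambda>\<theta>. p' \<theta> * sin (t * cos \<theta>) / t) = R t / t"
      unfolding R_def by (rule Henstock_Kurzweil_Integration.integral_divide)
    ultimately have two: "integral {0..pi/2} (\<lambda>\<theta>. (1 - cos (\<theta> / 2)) * cos (t * cos \<theta>)) = R t / t" by simp
    show ?thesis unfolding bessel_J0_cos split one two ..
  qed
  \<comment> \<open>After multiplication by t, the Fresnel error pi / (sqrt 2 * t), divided by sqrt
    t, becomes of order 1 / sqrt t; the term R t / t becomes R t, which tends to 0 without a
    rate.\<close>
  have bd: "\<bar>t * (bessel_J0 t - sqrt (2 / (pi * t)) * cos (t - pi / 4))\<bar> \<le> 1 / sqrt t + \<bar>R t\<bar>" if t: "t > 0" for t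
  proof -
    have "sqrt (2 / (pi * t)) = 2 / pi * (pi / (sqrt (2 * pi) * sqrt t))"
      using t by (simp add: real_sqrt_divide real_sqrt_mult field_simps flip: real_sqrt_mult[of 2 2])
    then have e: "t * (bessel_J0 t - sqrt (2 / (pi * t)) * cos (t - pi / 4))
      = 2 / (pi * sqrt (2 * pi)) * (t / sqrt t) * (sqrt (2 * pi) * I t - pi * cos (t - pi / 4)) + 2 / pi * R t"
      using t unfolding J[OF t] by (simp add: field_simps)
    have "\<bar>2 / (pi * sqrt (2 * pi)) * (t / sqrt t) * (sqrt (2 * pi) * I t - pi * cos (t - pi / 4))\<bar>
       \<le> 2 / (pi * sqrt (2 * pi)) * (t / sqrt t) * (pi / (sqrt 2 * t))"
      using fresnel_asymptotic[OF t] t unfolding abs_mult I_def by (intro mult_mono) auto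
    also have "\<dots> = 1 / (sqrt pi * sqrt t)"
      using t by (simp add: real_sqrt_mult field_simps)
    also have "\<dots> \<le> 1 / sqrt t"
    proof -
      have "1 \<le> sqrt pi" using pi_gt3 by simp
      then have "1 * sqrt t \<le> sqrt pi * sqrt t" using t by (intro mult_right_mono) auto
      then show ?thesis using t by (intro divide_left_mono) auto
    qed
    finally have 1: "\<bar>2 / (pi * sqrt (2 * pi)) * (t / sqrt t) * (sqrt (2 * pi) * I t - pi * cos (t - pi / 4))\<bar> \<le> 1 / sqrt t" .
    have "2 / pi \<le> 1" using pi_gt3 by simp
    then have 2: "\<bar>2 / pi * R t\<bar> \<le> \<bar>R t\<bar>" using mult_right_mono[of "2/pi" 1 "\<bar>R t\<bar>"] by (simp add: abs_mult)
    show ?thesis unfolding e using 1 2 by linarith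
  qed
  have lim: "((\<lambda>t. 1 / sqrt t + \<bar>R t\<bar>) \<longlongrightarrow> 0) at_top"
    using tendsto_add[OF real_tendsto_divide_at_top[OF tendsto_const sqrt_at_top] tendsto_rabs_zero[OF R0]] by simp
  show ?thesis
    by (rule Lim_null_comparison[OF _ lim]) (use bd in \<open>auto intro!: eventually_mono[OF eventually_gt_at_top[of 0]]\<close>)
qed

section \<open>Integration by parts on the pieces\<close>

text \<open>Values of a piecewise function at its break points are arbitrary; on each closed piece
  they are replaced by the one-sided limits.\<close>

lemma continuous_on_endpoint_extension:
  fixes h :: "real \<Rightarrow> 'a::real_normed_vector"
  assumes "p < q" "\<And>r. p < r \<Longrightarrow> r < q \<Longrightarrow> isCont h r" "(h \<longlongrightarrow> lp) (at_right p)" "(h \<longlongrightarrow> lq) (at_left q)"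
  shows "continuous_on {p..q} (\<lambda>r. if r = p then lp else if r = q then lq else h r)" (is "continuous_on _ ?H")
proof (rule continuous_on_IccI)
  show "(?H \<longlongrightarrow> ?H p) (at_right p)"
    using Lim_transform_eventually[OF assms(3), of ?H] eventually_mono[OF eventually_at_right_real[OF \<open>p < q\<close>]]
    by simp
  show "(?H \<longlongrightarrow> ?H q) (at_left q)"
    using Lim_transform_eventually[OF assms(4), of ?H] eventually_mono[OF eventually_at_left_real[OF \<open>p < q\<close>]] \<open>p < q\<close>
    by simp
  show "?H \<midarrow>r\<rightarrow> ?H r" if "p < r" "r < q" for r
  proof (rule Lim_transform_within_open)
    show "h \<midarrow>r\<rightarrow> ?H r" using assms(2)[OF that] that by (simp add: isCont_def)
    show "open {p<..<q}" "r \<in> {p<..<q}" using that by auto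
  qed auto
qed fact

lemma set_integrable_Icc_one_sided_limits:
  fixes h :: "real \<Rightarrow> complex"
  assumes "p < q" "\<And>r. p < r \<Longrightarrow> r < q \<Longrightarrow> isCont h r" "(h \<longlongrightarrow> lp) (at_right p)" "(h \<longlongrightarrow> lq) (at_left q)"
  shows "set_integrable lborel {p..q} h"
proof -
  have "set_integrable lborel {p..q} (\<lambda>r. if r = p then lp else if r = q then lq else h r)"
    by (intro borel_integrable_atLeastAtMost' continuous_on_endpoint_extension assms)
  then show ?thesis
    unfolding set_integrable_def
    by (subst integrable_discrete_difference[where X = "{p, q}" and g = "\<lambda>r. indicator {p..q} r *\<^sub>R (if r = p then lp else if r = q then lq else h r)"]) auto
qed

text \<open>The fundamental theorem for P * h, with h continued to the closed interval by its limits
  and the derivative taken in the interior. Integrability belongs to the conclusion, because the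
  gauge integral integrates every such derivative.\<close>

lemma has_integral_product_rule_one_sided_limits:
  fixes h h' :: "real \<Rightarrow> complex" and P P' :: "real \<Rightarrow> real"
  assumes "p < q" "\<And>r. p < r \<Longrightarrow> r < q \<Longrightarrow> (h has_vector_derivative h' r) (at r)"
    and "(h \<longlongrightarrow> lp) (at_right p)" "(h \<longlongrightarrow> lq) (at_left q)"
    and P: "\<And>r. (P has_real_derivative P' r) (at r)"
  shows "((\<lambda>r. P' r *\<^sub>R h r + P r *\<^sub>R h' r) has_integral (P q *\<^sub>R lq - P p *\<^sub>R lp)) {p..q}"
proof -
  define H where "H r = (if r = p then lp else if r = q then lq else h r)" for r
  have "continuous_on {p..q} H"
    unfolding H_def using assms by (intro continuous_on_endpoint_extension) (auto intro: has_vector_derivative_continuous)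
  moreover have "continuous_on {p..q} P" using P by (meson DERIV_isCont continuous_at_imp_continuous_on)
  ultimately have c: "continuous_on {p..q} (\<lambda>r. P r *\<^sub>R H r)" by (intro continuous_on_scaleR)
  have "((\<lambda>r. P' r *\<^sub>R h r + P r *\<^sub>R h' r) has_integral (P q *\<^sub>R H q - P p *\<^sub>R H p)) {p..q}"
  proof (rule fundamental_theorem_of_calculus_interior[OF _ c])
    fix r assume r: "r \<in> {p<..<q}"
    have "((\<lambda>r. P r *\<^sub>R h r) has_vector_derivative P r *\<^sub>R h' r + P' r *\<^sub>R h r) (at r)"
      using r by (intro has_vector_derivative_scaleR P assms(2)) auto
    then show "((\<lambda>r. P r *\<^sub>R H r) has_vector_derivative P' r *\<^sub>R h r + P r *\<^sub>R h' r) (at r)"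
      unfolding add.commute[of "P r *\<^sub>R h' r"]
      by (rule has_vector_derivative_transform_within_open[where S = "{p<..<q}"]) (use r in \<open>auto simp: H_def\<close>)
  qed (use \<open>p < q\<close> in simp)
  then show ?thesis using \<open>p < q\<close> by (simp add: H_def)
qed

text \<open>Induction on the largest break point b. The right end q and its limit are generalised,
  as for the remaining points they become b and the left limit \<open>L b\<close>.\<close>

lemma set_integrable_piecewise:
  fixes h :: "real \<Rightarrow> complex"
  assumes "finite A"
    and "A \<subseteq> {p<..<q}" "p < q" "\<And>r. r \<in> {p<..<q} - A \<Longrightarrow> isCont h r" "(h \<longlongrightarrow> lp) (at_right p)" "(h \<longlongrightarrow> lq) (at_left q)"
    and "\<And>a. a \<in> A \<Longrightarrow> (h \<longlongrightarrow> L a) (at_left a)" "\<And>a. a \<in> A \<Longrightarrow> (h \<longlongrightarrow> L' a) (at_right a)"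
  shows "set_integrable lborel {p..q} h"
  using assms
proof (induction arbitrary: q lq rule: finite_linorder_max_induct)
  case empty
  then show ?case by (intro set_integrable_Icc_one_sided_limits) auto
next
  case (insert b A)
  have b: "p < b" "b < q" using insert.prems by auto
  have A: "A \<subseteq> {p<..<b}" and B: "\<And>r. b < r \<Longrightarrow> r < q \<Longrightarrow> r \<in> {p<..<q} - insert b A"
    and C: "\<And>r. r \<in> {p<..<b} - A \<Longrightarrow> r \<in> {p<..<q} - insert b A"
    using insert.hyps insert.prems(1) b by fastforce+
  have "set_integrable lborel {p..b} h"
    by (rule insert.IH[OF A b(1) insert.prems(3)[OF C] insert.prems(4) insert.prems(6)[OF insertI1]
          insert.prems(6,7)[OF insertI2]])
  moreover have "set_integrable lborel {b..q} h"
    by (rule set_integrable_Icc_one_sided_limits[OF b(2) insert.prems(3)[OF B] insert.prems(7)[OF insertI1] insert.prems(5)])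
  ultimately have "set_integrable lborel ({p..b} \<union> {b..q}) h" by (intro set_integrable_Un) auto
  then show ?case using b by (simp add: ivl_disj_un_two_touch less_imp_le)
qed

text \<open>Each break point b is the right end of one piece and the left end of the next, so it
  contributes P b times \<open>L b - L' b\<close>. This is the source of the jump terms and of their
  sign.\<close>

lemma has_integral_product_rule_piecewise:
  fixes h h' :: "real \<Rightarrow> complex" and P P' :: "real \<Rightarrow> real"
  assumes P: "\<And>r. (P has_real_derivative P' r) (at r)"
    and "finite A"
    and "A \<subseteq> {p<..<q}" "p < q" "\<And>r. r \<in> {p<..<q} - A \<Longrightarrow> (h has_vector_derivative h' r) (at r)"
    and "(h \<longlongrightarrow> lp) (at_right p)" "(h \<longlongrightarrow> lq) (at_left q)"
    and "\<And>a. a \<in> A \<Longrightarrow> (h \<longlongrightarrow> L a) (at_left a)" "\<And>a. a \<in> A \<Longrightarrow> (h \<longlongrightarrow> L' a) (at_right a)"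
  shows "((\<lambda>r. P' r *\<^sub>R h r + P r *\<^sub>R h' r) has_integral
     (P q *\<^sub>R lq - P p *\<^sub>R lp - (\<Sum>a\<in>A. P a *\<^sub>R (L' a - L a)))) {p..q}"
  using assms(2-)
proof (induction arbitrary: q lq rule: finite_linorder_max_induct)
  case empty
  then show ?case using has_integral_product_rule_one_sided_limits[OF _ _ _ _ P, of p q h h' lp lq] by simp
next
  case (insert b A)
  have b: "p < b" "b < q" using insert.prems by auto
  have A: "A \<subseteq> {p<..<b}" and B: "\<And>r. b < r \<Longrightarrow> r < q \<Longrightarrow> r \<in> {p<..<q} - insert b A"
    and C: "\<And>r. r \<in> {p<..<b} - A \<Longrightarrow> r \<in> {p<..<q} - insert b A"
    using insert.hyps insert.prems(1) b by fastforce+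
  have "((\<lambda>r. P' r *\<^sub>R h r + P r *\<^sub>R h' r) has_integral
     (P b *\<^sub>R L b - P p *\<^sub>R lp - (\<Sum>a\<in>A. P a *\<^sub>R (L' a - L a)))) {p..b}"
    by (rule insert.IH[OF A b(1) insert.prems(3)[OF C] insert.prems(4) insert.prems(6)[OF insertI1]
          insert.prems(6,7)[OF insertI2]])
  moreover have "((\<lambda>r. P' r *\<^sub>R h r + P r *\<^sub>R h' r) has_integral (P q *\<^sub>R lq - P b *\<^sub>R L' b)) {b..q}"
    by (rule has_integral_product_rule_one_sided_limits[OF b(2) insert.prems(3)[OF B] insert.prems(7)[OF insertI1] insert.prems(5) P])
  ultimately have "((\<lambda>r. P' r *\<^sub>R h r + P r *\<^sub>R h' r) has_integral
     (P b *\<^sub>R L b - P p *\<^sub>R lp - (\<Sum>a\<in>A. P a *\<^sub>R (L' a - L a))) + (P q *\<^sub>R lq - P b *\<^sub>R L' b)) {p..q}"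
    using b by (intro has_integral_combine[of p b q]) auto
  moreover have "b \<notin> A" using insert.hyps by auto
  ultimately show ?case using insert.hyps by (simp add: algebra_simps)
qed

text \<open>Off A every derivative up to order k is continuous, so its one-sided limits agree. The
  inclusion may be strict, A being any finite set that witnesses piecewise smoothness; integration
  by parts runs over A, while the theorem sums over the jump points.\<close>

lemma jump_points_subset:
  assumes "finite A" "A \<subseteq> {0<..}" "C_k_on k g ({0<..} - A)"
  shows "jump_points k g \<subseteq> A"
proof
  fix b assume "b \<in> jump_points k g"
  then obtain j where b: "0 < b" and j: "j \<le> k"
    and ne: "Lim (at_left b) (nth_vector_derivative j g) \<noteq> Lim (at_right b) (nth_vector_derivative j g)"
    by (auto simp: jump_points_def)
  show "b \<in> A"
  proof (rule ccontr)
    assume "b \<notin> A"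
    moreover have "open ({0<..} - A)" using assms(1) by (intro open_Diff finite_imp_closed) auto
    ultimately have "isCont (nth_vector_derivative j g) b"
      using assms(3) b j unfolding C_k_on_def by (auto simp: continuous_on_eq_continuous_at)
    then have l: "(nth_vector_derivative j g \<longlongrightarrow> nth_vector_derivative j g b) (at_left b)"
      and r: "(nth_vector_derivative j g \<longlongrightarrow> nth_vector_derivative j g b) (at_right b)"
      by (auto simp: isCont_def intro: filterlim_mono at_le)
    show False using ne tendsto_Lim[OF _ l] tendsto_Lim[OF _ r] by simp
  qed
qed

text \<open>For r > 0 the argument M * r tends to infinity and the tail to 0, under the bound B
  times the norm of h. At r = 0 the tail stays at -1, but that is a single point.\<close>

lemma integral_bessel_J0_tail_tendsto:
  fixes h :: "real \<Rightarrow> complex"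
  assumes h: "set_integrable lborel {0..R} h"
  shows "((\<lambda>M. integral {0..R} (\<lambda>r. bessel_J0_tail (M * r) *\<^sub>R h r)) \<longlongrightarrow> 0) at_top"
proof -
  obtain B where B: "\<And>t. t \<ge> 0 \<Longrightarrow> \<bar>bessel_J0_tail t\<bar> \<le> B" using bessel_J0_tail_bounded by blast
  define s where "s M r = bessel_J0_tail (M * r) *\<^sub>R (indicator {0..R} r *\<^sub>R h r)" for M r
  define w where "w r = B * norm (indicator {0..R} r *\<^sub>R h r)" for r
  have hi: "integrable lborel (\<lambda>r. indicator {0..R} r *\<^sub>R h r)" using h by (simp add: set_integrable_def)
  have [measurable]: "bessel_J0_tail \<in> borel_measurable borel"
    by (intro borel_measurable_continuous_onI) (meson DERIV_isCont bessel_J0_tail_deriv continuous_at_imp_continuous_on)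
  have sm: "s M \<in> borel_measurable lborel" for M
    unfolding s_def[abs_def] using borel_measurable_integrable[OF hi] by measurable
  have wi: "integrable lborel w" unfolding w_def[abs_def] using hi by (intro integrable_mult_right integrable_norm)
  have bd: "norm (s M r) \<le> w r" if "M \<ge> 0" for M r
    using B[of "M * r"] that by (cases "r \<in> {0..R}") (auto simp: s_def w_def mult_right_mono)
  have "((\<lambda>M. integral\<^sup>L lborel (s M)) \<longlongrightarrow> integral\<^sup>L lborel (\<lambda>r::real. 0)) at_top"
  proof (rule integral_dominated_convergence_at_top[where w = w])
    show "s M \<in> borel_measurable lborel" for M by (rule sm)
    show "integrable lborel w" by (rule wi)
    show "AE r in lborel. ((\<lambda>M. s M r) \<longlongrightarrow> 0) at_top"
      using AE_lborel_singleton[of 0]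
    proof eventually_elim
      case (elim r)
      show ?case
      proof (cases "r \<in> {0..R}")
        case True
        then have "r > 0" using elim by simp
        then have "filterlim (\<lambda>M. M * r) at_top at_top"
          by (intro filterlim_at_top_mult_tendsto_pos[OF tendsto_const _ filterlim_ident])
        from filterlim_compose[OF bessel_J0_tail_at_top this]
        have "((\<lambda>M. s M r) \<longlongrightarrow> 0 *\<^sub>R (indicator {0..R} r *\<^sub>R h r)) at_top"
          unfolding s_def by (intro tendsto_scaleR tendsto_const)
        then show ?thesis by simp
      qed (simp add: s_def)
    qed
    show "eventually (\<lambda>M. AE r in lborel. norm (s M r) \<le> w r) at_top"
      using eventually_ge_at_top[of 0] by eventually_elim (use bd in auto)
  qed simp
  then have lim: "((\<lambda>M. integral\<^sup>L lborel (s M)) \<longlongrightarrow> 0) at_top" by simp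
  have "integral\<^sup>L lborel (s M) = integral {0..R} (\<lambda>r. bessel_J0_tail (M * r) *\<^sub>R h r)" if "M \<ge> 0" for M
  proof -
    have "integrable lborel (s M)"
      by (rule Bochner_Integration.integrable_bound[OF wi sm]) (use bd[OF that] in \<open>auto intro!: AE_I2 order_trans[OF _ abs_ge_self]\<close>)
    moreover have s: "s M = (\<lambda>r. indicator {0..R} r *\<^sub>R (bessel_J0_tail (M * r) *\<^sub>R h r))"
      by (auto simp: s_def fun_eq_iff)
    ultimately have "set_integrable lborel {0..R} (\<lambda>r. bessel_J0_tail (M * r) *\<^sub>R h r)"
      by (simp add: set_integrable_def)
    from set_borel_integral_eq_integral(2)[OF this] show ?thesis
      unfolding set_lebesgue_integral_def s .
  qed
  then show ?thesis
    by (intro Lim_transform_eventually[OF lim] eventually_mono[OF eventually_ge_at_top[of 0]]) auto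
qed

lemma tendsto_zero_at_left:
  fixes h :: "real \<Rightarrow> 'a::real_normed_vector"
  assumes "\<And>r. r > R0 \<Longrightarrow> h r = 0" "R0 < R"
  shows "(h \<longlongrightarrow> 0) (at_left R)"
  by (rule tendsto_eventually) (use assms eventually_at_left_real[OF assms(2)] in \<open>auto elim: eventually_mono\<close>)

text \<open>Integrating by parts against \<open>bessel_J0 (M * r)\<close>, whose derivative is \<open>- M * bessel_J1 (M * r)\<close>,
  and once more against \<open>bessel_J0_tail (M * r) / M\<close>.\<close>

lemma spherical_partial_sum_expansion:
  fixes g g1 g2 :: "real \<Rightarrow> complex"
  assumes f: "integrable lebesgue f" and g: "g = spherical_mean f x" and M: "M > 0"
    and A: "finite A" "A \<subseteq> {0<..<R}" "0 < R0" "R0 < R"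
    and g1: "\<And>r. r \<in> {0<..<R} - A \<Longrightarrow> (g has_vector_derivative g1 r) (at r)"
    and g2: "\<And>r. r \<in> {0<..<R} - A \<Longrightarrow> (g1 has_vector_derivative g2 r) (at r)"
    and z: "\<And>r. r > R0 \<Longrightarrow> g r = 0" "\<And>r. r > R0 \<Longrightarrow> g1 r = 0"
    and l0: "(g \<longlongrightarrow> l) (at_right 0)" "(g1 \<longlongrightarrow> l') (at_right 0)"
    and lA: "\<And>a. a \<in> A \<Longrightarrow> (g \<longlongrightarrow> L a) (at_left a)" "\<And>a. a \<in> A \<Longrightarrow> (g \<longlongrightarrow> L' a) (at_right a)"
    and lA1: "\<And>a. a \<in> A \<Longrightarrow> (g1 \<longlongrightarrow> L1 a) (at_left a)" "\<And>a. a \<in> A \<Longrightarrow> (g1 \<longlongrightarrow> L1' a) (at_right a)"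
  shows "spherical_partial_sum f M x = l + (\<Sum>a\<in>A. bessel_J0 (M * a) *\<^sub>R (L' a - L a))
    + (l' - (\<Sum>a\<in>A. bessel_J0_tail (M * a) *\<^sub>R (L1' a - L1 a))
        - integral {0..R} (\<lambda>r. bessel_J0_tail (M * r) *\<^sub>R g2 r)) /\<^sub>R M"
proof -
  have R: "0 < R" using A by simp
  have dJ: "((\<lambda>r. bessel_J0 (M * r)) has_real_derivative - (M * bessel_J1 (M * r))) (at r)" for r
    by (rule DERIV_cong[OF DERIV_chain2[OF bessel_J0_deriv]]) (auto intro!: derivative_eq_intros)
  have dG: "((\<lambda>r. bessel_J0_tail (M * r) / M) has_real_derivative bessel_J0 (M * r)) (at r)" for r
    by (rule DERIV_cong[OF DERIV_cdivide[OF DERIV_chain2[OF bessel_J0_tail_deriv]]])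
      (use M in \<open>auto intro!: derivative_eq_intros\<close>)
  define S where "S = (\<Sum>a\<in>A. bessel_J0 (M * a) *\<^sub>R (L' a - L a))"
  define S1 where "S1 = (\<Sum>a\<in>A. bessel_J0_tail (M * a) *\<^sub>R (L1' a - L1 a))"
  \<comment> \<open>As R0 < R, the function g vanishes on a left neighbourhood of R, so the upper
    boundary term is 0; at the lower one \<open>bessel_J0\<close> has the value 1.\<close>
  have "((\<lambda>r. (- (M * bessel_J1 (M * r))) *\<^sub>R g r + bessel_J0 (M * r) *\<^sub>R g1 r) has_integral
     (bessel_J0 (M * R) *\<^sub>R 0 - bessel_J0 (M * 0) *\<^sub>R l - S)) {0..R}"
    unfolding S_def
    by (rule has_integral_product_rule_piecewise[OF dJ A(1,2) R g1 l0(1) tendsto_zero_at_left[OF z(1) A(4)] lA])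
  then have 1: "((\<lambda>r. (- (M * bessel_J1 (M * r))) *\<^sub>R g r + bessel_J0 (M * r) *\<^sub>R g1 r) has_integral (- l - S)) {0..R}"
    by (simp add: bessel_J0_0)
  have "((\<lambda>r. bessel_J0 (M * r) *\<^sub>R g1 r + (bessel_J0_tail (M * r) / M) *\<^sub>R g2 r) has_integral
     ((bessel_J0_tail (M * R) / M) *\<^sub>R 0 - (bessel_J0_tail (M * 0) / M) *\<^sub>R l'
       - (\<Sum>a\<in>A. (bessel_J0_tail (M * a) / M) *\<^sub>R (L1' a - L1 a)))) {0..R}"
    by (rule has_integral_product_rule_piecewise[OF dG A(1,2) R g2 l0(2) tendsto_zero_at_left[OF z(2) A(4)] lA1])
  moreover have "(\<Sum>a\<in>A. (bessel_J0_tail (M * a) / M) *\<^sub>R (L1' a - L1 a)) = S1 /\<^sub>R M"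
    by (simp add: S1_def scaleR_right.sum divide_inverse mult.commute)
  \<comment> \<open>The value -1 of \<open>bessel_J0_tail\<close> at 0 turns the lower boundary term
    into + l' / M.\<close>
  ultimately have 2: "((\<lambda>r. bessel_J0 (M * r) *\<^sub>R g1 r + (bessel_J0_tail (M * r) / M) *\<^sub>R g2 r) has_integral
      ((l' - S1) /\<^sub>R M)) {0..R}"
    by (simp add: bessel_J0_tail_0 scaleR_diff_right divide_inverse)
  have 3: "((\<lambda>r. (M * bessel_J1 (M * r)) *\<^sub>R g r) has_integral spherical_partial_sum f M x) {0..R}"
  proof -
    have "((\<lambda>r. (M * bessel_J1 (M * r)) *\<^sub>R g r) has_integral spherical_partial_sum f M x) {0<..}"
      using spherical_partial_sum_has_integral[OF f M, of x] by (simp add: g scaleR_conv_of_real)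
    moreover have "{r \<in> {0<..} - {0..R}. (M * bessel_J1 (M * r)) *\<^sub>R g r \<noteq> 0} = {}"
    proof -
      have "g r = 0" if "r \<in> {0<..} - {0..R}" for r using that A(4) by (intro z(1)) auto
      then show ?thesis by (metis (mono_tags, lifting) Collect_empty_eq scaleR_zero_right)
    qed
    then have "negligible {r \<in> {0<..} - {0..R}. (M * bessel_J1 (M * r)) *\<^sub>R g r \<noteq> 0}"
      by (simp only: negligible_empty)
    moreover have "negligible {r \<in> {0..R} - {0<..}. (M * bessel_J1 (M * r)) *\<^sub>R g r \<noteq> 0}"
      by (rule negligible_subset[OF negligible_sing[of 0]]) auto
    ultimately show ?thesis by (rule has_integral_spike_set_eq[THEN iffD1, rotated 2])
  qed
  \<comment> \<open>Facts 1 and 2 share the term \<open>bessel_J0 (M * r) *\<^sub>R g1 r\<close>.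
    The combination 2 - (1 + 3) leaves only the term with g2 and provides its integrability at the
    same time.\<close>
  have cancel: "(u + v) - (((- m) *\<^sub>R w + u) + m *\<^sub>R w) = v" for u v w :: complex and m :: real
    by simp
  have "((\<lambda>r. (bessel_J0_tail (M * r) / M) *\<^sub>R g2 r) has_integral
     ((l' - S1) /\<^sub>R M - (- l - S + spherical_partial_sum f M x))) {0..R}"
    using has_integral_diff[OF 2 has_integral_add[OF 1 3]] by (simp only: cancel)
  then have "integral {0..R} (\<lambda>r. (bessel_J0_tail (M * r) / M) *\<^sub>R g2 r)
     = (l' - S1) /\<^sub>R M - (- l - S + spherical_partial_sum f M x)"
    by (rule integral_unique)
  moreover have "(\<lambda>r. (bessel_J0_tail (M * r) / M) *\<^sub>R g2 r) = (\<lambda>r. inverse M *\<^sub>R (bessel_J0_tail (M * r) *\<^sub>R g2 r))"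
    by (simp add: divide_inverse mult.commute)
  ultimately have "integral {0..R} (\<lambda>r. bessel_J0_tail (M * r) *\<^sub>R g2 r) /\<^sub>R M
     = (l' - S1) /\<^sub>R M - (- l - S + spherical_partial_sum f M x)"
    by (simp only: Henstock_Kurzweil_Integration.integral_cmul)
  then show ?thesis unfolding S_def[symmetric] S1_def[symmetric] by (simp add: algebra_simps)
qed

theorem mainTheorem1:
  fixes f :: "real \<times> real \<Rightarrow> complex" and x :: "real \<times> real"
    and a :: "nat \<Rightarrow> real" and K :: nat
  assumes "integrable lebesgue f"
    and "piecewise_smooth_wrt 2 f x"
    and "bij_betw a {1..K} (jump_points 2 (spherical_mean f x))"
  shows "(\<lambda>M::real.
            (spherical_partial_sum f M x - Lim (at_right 0) (spherical_mean f x))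
            - (of_real (sqrt (2 / (M * pi))) *
                 (\<Sum>i=1..K. jump (spherical_mean f x) (a i) *
                    of_real (cos (M * a i - pi / 4) / sqrt (a i)))
               + of_real (1 / M) *
                 Lim (at_right 0) (nth_vector_derivative 1 (spherical_mean f x))))
         \<in> o[at_top](\<lambda>M. of_real (1 / M))"
proof -
  define g where "g = spherical_mean f x"
  define g1 where "g1 = nth_vector_derivative 1 g"
  define g2 where "g2 = nth_vector_derivative 2 g"
  have n0: "nth_vector_derivative 0 g = g" by (simp add: nth_vector_derivative_def)
  have n1: "g1 r = vector_derivative g (at r)" for r by (simp add: g1_def nth_vector_derivative_def)
  have n2: "g2 r = vector_derivative g1 (at r)" for r
    by (simp add: g2_def g1_def nth_vector_derivative_def numeral_2_eq_2)
  from assms(2) obtain R1 where "piecewise_C_k 2 g" and R1: "\<And>r. r \<ge> R1 \<Longrightarrow> g r = 0"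
    by (auto simp: piecewise_smooth_wrt_def g_def)
  then obtain A where A: "finite A" "A \<subseteq> {0<..}" and Ck: "C_k_on 2 g ({0<..} - A)"
    and lim: "\<And>j. j \<le> 2 \<Longrightarrow> \<exists>l. (nth_vector_derivative j g \<longlongrightarrow> l) (at_right 0)"
      "\<And>j a. j \<le> 2 \<Longrightarrow> a \<in> A \<Longrightarrow> \<exists>l. (nth_vector_derivative j g \<longlongrightarrow> l) (at_left a)"
      "\<And>j a. j \<le> 2 \<Longrightarrow> a \<in> A \<Longrightarrow> \<exists>l. (nth_vector_derivative j g \<longlongrightarrow> l) (at_right a)"
    unfolding piecewise_C_k_def by blast
  \<comment> \<open>\<open>Lim\<close> is a definite description; the existence granted by piecewise
    smoothness makes it an actual limit, here and at the points of A.\<close>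
  have Lr: "(nth_vector_derivative j g \<longlongrightarrow> Lim (at_right 0) (nth_vector_derivative j g)) (at_right 0)" if "j \<le> 2" for j
    using lim(1)[OF that] tendsto_Lim[OF trivial_limit_at_right_real] by metis
  have LA: "(nth_vector_derivative j g \<longlongrightarrow> Lim (at_left a) (nth_vector_derivative j g)) (at_left a)" if "j \<le> 2" "a \<in> A" for j a
    using lim(2)[OF that] tendsto_Lim[OF trivial_limit_at_left_real] by metis
  have RA: "(nth_vector_derivative j g \<longlongrightarrow> Lim (at_right a) (nth_vector_derivative j g)) (at_right a)" if "j \<le> 2" "a \<in> A" for j a
    using lim(3)[OF that] tendsto_Lim[OF trivial_limit_at_right_real] by metis
  \<comment> \<open>Beyond the support of g and beyond all of A; the further step to R leaves room
    for g to vanish to the left of R.\<close>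
  define R0 where "R0 = max 1 (Max (insert R1 A))"
  define R where "R = R0 + 1"
  have R0: "0 < R0" "R0 < R" "R1 \<le> R0" "\<And>a. a \<in> A \<Longrightarrow> a \<le> R0"
    using A(1) by (auto simp: R0_def R_def le_max_iff_disj)
  have AR: "A \<subseteq> {0<..<R}" using R0(2,4) A(2) by fastforce
  have d: "\<And>r. r \<in> {0<..} - A \<Longrightarrow> (g has_vector_derivative g1 r) (at r)"
    "\<And>r. r \<in> {0<..} - A \<Longrightarrow> (g1 has_vector_derivative g2 r) (at r)"
  proof -
    fix r assume r: "r \<in> {0<..} - A"
    have "nth_vector_derivative 0 g differentiable (at r)" "nth_vector_derivative 1 g differentiable (at r)"
      using Ck r unfolding C_k_on_def by auto
    then show "(g has_vector_derivative g1 r) (at r)" "(g1 has_vector_derivative g2 r) (at r)"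
      unfolding n1 n2 n0 g1_def[symmetric] by (simp_all add: vector_derivative_works)
  qed
  have c2: "isCont g2 r" if "r \<in> {0<..} - A" for r
  proof -
    have "open ({0<..} - A)" using A(1) by (intro open_Diff finite_imp_closed) auto
    then show ?thesis using Ck that unfolding C_k_on_def g2_def by (auto simp: continuous_on_eq_continuous_at)
  qed
  \<comment> \<open>A derivative depends on a whole neighbourhood, so vanishing is passed from g to
    g1 and g2 on the open half-line beyond R0.\<close>
  have zero_deriv: "vector_derivative h (at r) = 0" if "\<And>r. r > R0 \<Longrightarrow> h r = 0" "r > R0" for h :: "real \<Rightarrow> complex" and r
  proof (rule vector_derivative_at)
    show "(h has_vector_derivative 0) (at r)"
      by (rule has_vector_derivative_transform_within_open[OF has_vector_derivative_const, where S = "{R0<..}"])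
        (use that in auto)
  qed
  have z0: "g r = 0" if "r > R0" for r using R1 R0(3) that by simp
  have z1: "g1 r = 0" if "r > R0" for r unfolding n1 using zero_deriv z0 that by blast
  have z2: "g2 r = 0" if "r > R0" for r unfolding n2 using zero_deriv z1 that by blast
  define l where "l = Lim (at_right 0) g"
  define l' where "l' = Lim (at_right 0) g1"
  \<comment> \<open>The jump of the derivative g1, not a Bessel function.\<close>
  define J1 where "J1 a = Lim (at_right a) g1 - Lim (at_left a) g1" for a
  have g2_int: "set_integrable lborel {0..R} g2"
    using R0(1,2) by (intro set_integrable_piecewise[OF A(1) AR _ c2 _ tendsto_zero_at_left[OF z2 R0(2)]])
      (auto intro: Lr[of 2, folded g2_def] LA[of 2, folded g2_def] RA[of 2, folded g2_def])
  define T where "T M = integral {0..R} (\<lambda>r. bessel_J0_tail (M * r) *\<^sub>R g2 r)" for M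
  have T0: "(T \<longlongrightarrow> 0) at_top" unfolding T_def[abs_def] by (rule integral_bessel_J0_tail_tendsto[OF g2_int])
  have expansion: "spherical_partial_sum f M x = l + (\<Sum>a\<in>A. bessel_J0 (M * a) *\<^sub>R jump g a)
    + (l' - (\<Sum>a\<in>A. bessel_J0_tail (M * a) *\<^sub>R J1 a) - T M) /\<^sub>R M" if "M > 0" for M
    unfolding jump_def J1_def T_def
    by (rule spherical_partial_sum_expansion[OF assms(1) g_def that A(1) AR R0(1,2) d z0 z1])
      (auto simp: l_def l'_def intro: Lr[of 0, unfolded n0] Lr[of 1, folded g1_def]
        LA[of 0, unfolded n0] RA[of 0, unfolded n0] LA[of 1, folded g1_def] RA[of 1, folded g1_def])
  \<comment> \<open>At a point of A that is not a jump point the limits for j = 0 agree, so its jump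
    is 0 and the point may be added to the sum.\<close>
  have reindex: "(\<Sum>i=1..K. jump g (a i) * of_real (cos (M * a i - pi / 4) / sqrt (a i)))
     = (\<Sum>b\<in>A. jump g b * of_real (cos (M * b - pi / 4) / sqrt b))" for M
  proof -
    have "(\<Sum>i=1..K. jump g (a i) * of_real (cos (M * a i - pi / 4) / sqrt (a i)))
      = (\<Sum>b\<in>jump_points 2 g. jump g b * of_real (cos (M * b - pi / 4) / sqrt b))"
      using assms(3) unfolding g_def[symmetric] by (rule sum.reindex_bij_betw)
    also have "\<dots> = (\<Sum>b\<in>A. jump g b * of_real (cos (M * b - pi / 4) / sqrt b))"
    proof (rule sum.mono_neutral_left[OF A(1) jump_points_subset[OF A Ck]])
      show "\<forall>b\<in>A - jump_points 2 g. jump g b * of_real (cos (M * b - pi / 4) / sqrt b) = 0"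
      proof
        fix b assume "b \<in> A - jump_points 2 g"
        then have "Lim (at_left b) (nth_vector_derivative 0 g) = Lim (at_right b) (nth_vector_derivative 0 g)"
          using A(2) unfolding jump_points_def by fastforce
        then show "jump g b * of_real (cos (M * b - pi / 4) / sqrt b) = 0" by (simp add: jump_def n0)
      qed
    qed
    finally show ?thesis .
  qed
  \<comment> \<open>Scaled so that M times the error of the cosine at the point b is
    \<open>\<epsilon> (M * b) / b\<close>, which tends to 0 by
    \<open>bessel_J0_asymptotic\<close>.\<close>
  define \<epsilon> where "\<epsilon> t = t * (bessel_J0 t - sqrt (2 / (pi * t)) * cos (t - pi / 4))" for t
  have at_top_A: "filterlim (\<lambda>M. M * b) at_top at_top" if "b \<in> A" for b
    using that A(2) by (intro filterlim_at_top_mult_tendsto_pos[OF tendsto_const _ filterlim_ident]) auto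
  define X where "X M = (spherical_partial_sum f M x - l)
      - (of_real (sqrt (2 / (M * pi))) * (\<Sum>b\<in>A. jump g b * of_real (cos (M * b - pi / 4) / sqrt b)) + of_real (1 / M) * l')" for M
  \<comment> \<open>An exact identity: in M * X M the value at 0 and the term l' cancel. What is
    left are the errors of the cosine, the derivative jumps weighted by the tail, and the remainder
    T, each tending to 0.\<close>
  have X: "X M / of_real (1 / M) = (\<Sum>b\<in>A. (\<epsilon> (M * b) / b) *\<^sub>R jump g b) - (\<Sum>b\<in>A. bessel_J0_tail (M * b) *\<^sub>R J1 b) - T M"
    if M: "M > 0" for M
  proof -
    have sq: "sqrt (2 / (pi * (M * b))) = sqrt (2 / (M * pi)) / sqrt b" if "b \<in> A" for b
      by (simp add: real_sqrt_divide real_sqrt_mult mult_ac)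
    have summand: "(\<epsilon> (M * b) / b) *\<^sub>R jump g b = M *\<^sub>R (bessel_J0 (M * b) *\<^sub>R jump g b
        - of_real (sqrt (2 / (M * pi))) * (jump g b * of_real (cos (M * b - pi / 4) / sqrt b)))" if "b \<in> A" for b
    proof -
      have "b > 0" using that A(2) by auto
      then have "\<epsilon> (M * b) / b = M * (bessel_J0 (M * b) - sqrt (2 / (M * pi)) * (cos (M * b - pi / 4) / sqrt b))"
        by (simp add: \<epsilon>_def sq[OF that])
      moreover have "(M * (u - v * w)) *\<^sub>R z = M *\<^sub>R (u *\<^sub>R z - of_real v * (z * of_real w))" for u v w and z :: complex
        by (simp add: scaleR_conv_of_real algebra_simps)
      ultimately show ?thesis by (simp only:)
    qed
    have "(\<Sum>b\<in>A. (\<epsilon> (M * b) / b) *\<^sub>R jump g b)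
      = M *\<^sub>R ((\<Sum>b\<in>A. bessel_J0 (M * b) *\<^sub>R jump g b)
          - of_real (sqrt (2 / (M * pi))) * (\<Sum>b\<in>A. jump g b * of_real (cos (M * b - pi / 4) / sqrt b)))"
      by (simp add: summand sum_subtractf scaleR_right.sum[symmetric] sum_distrib_left)
    moreover have "X M / of_real (1 / M) = M *\<^sub>R X M" by (simp add: scaleR_conv_of_real)
    moreover have "M *\<^sub>R (of_real (1 / M) * l') = l'" "M *\<^sub>R (v /\<^sub>R M) = v" for v :: complex
      using M by (simp_all add: scaleR_conv_of_real)
    ultimately show ?thesis
      unfolding X_def expansion[OF M] by (simp add: scaleR_diff_right scaleR_add_right)
  qed
  have "((\<lambda>M. (\<Sum>b\<in>A. (\<epsilon> (M * b) / b) *\<^sub>R jump g b) - (\<Sum>b\<in>A. bessel_J0_tail (M * b) *\<^sub>R J1 b) - T M)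
    \<longlongrightarrow> (\<Sum>b\<in>A. (0 / b) *\<^sub>R jump g b) - (\<Sum>b\<in>A. 0 *\<^sub>R J1 b) - 0) at_top"
    using A(2)
    by (intro tendsto_diff tendsto_sum tendsto_scaleR tendsto_const tendsto_divide T0
        filterlim_compose[OF bessel_J0_asymptotic[folded \<epsilon>_def] at_top_A]
        filterlim_compose[OF bessel_J0_tail_at_top at_top_A]) auto
  then have lim: "((\<lambda>M. (\<Sum>b\<in>A. (\<epsilon> (M * b) / b) *\<^sub>R jump g b) - (\<Sum>b\<in>A. bessel_J0_tail (M * b) *\<^sub>R J1 b) - T M) \<longlongrightarrow> 0) at_top"
    by simp
  have "((\<lambda>M. X M / of_real (1 / M)) \<longlongrightarrow> 0) at_top"
  proof (rule Lim_transform_eventually[OF lim])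
    show "eventually (\<lambda>M. (\<Sum>b\<in>A. (\<epsilon> (M * b) / b) *\<^sub>R jump g b) - (\<Sum>b\<in>A. bessel_J0_tail (M * b) *\<^sub>R J1 b) - T M
        = X M / of_real (1 / M)) at_top"
      using eventually_gt_at_top[of 0] by eventually_elim (rule X[symmetric])
  qed
  then have "X \<in> o[at_top](\<lambda>M. of_real (1 / M))"
    by (rule smalloI_tendsto) (auto intro!: eventually_mono[OF eventually_gt_at_top[of 0]])
  then show ?thesis
    unfolding g_def[symmetric] g1_def[symmetric] l_def[symmetric] l'_def[symmetric] reindex
    by (simp only: X_def[abs_def])
qed

end
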